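(* Let $f\in L^1(S^1)$ be an even function such that $\|f\|_{L^1}<\frac{1}{\sqrt{2\pi}}$. If there exists $\tau>0$ such that $\frac1\tau<f<\tau$ almost everywhere on $S^1$, then there exist at least two (distinct) origin-symmetric convex bodies $K_1$ and $K_2$ in $\mathbb{R}^2$ such that $$dS_{\gamma_2,K_1}(v)=dS_{\gamma_2,K_2}(v)=f(v)\,dv .$$
   Context: A convex body in $\mathbb{R}^2$ is a compact convex set with nonempty interior. A function $f$ on the unit circle $S^1$ is even if $f(-v)=f(v)$; $K$ is origin-symmetric if $K=-K$. For a convex body $K$ containing the origin in its interior, its Gaussian surface area measure is the Borel measure on $S^1$ given by $S_{\gamma_2,K}(\eta)=\frac{1}{2\pi}\int_{\nu_K^{-1}(\eta)} e^{-|x|^2/2}\,d\mathcal{H}^1(x)$, where $\nu_K^{-1}(\eta)$ is the set of boundary points of $K$ having an outer unit normal in $\eta$. Here $dv$ is spherical Lebesgue measure (arc length) on $S^1$, and $\|f\|_{L^1}$ is taken with respect to it. *)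

theory Defs
  imports "HOL-Analysis.Analysis"
begin

definition hausdorff1_content :: "real \<Rightarrow> 'a::metric_space set \<Rightarrow> ennreal" where
  "hausdorff1_content \<delta> A =
     (INF U \<in> {U :: nat \<Rightarrow> 'a set. A \<subseteq> (\<Union>i. U i) \<and> (\<forall>i. bounded (U i) \<and> diameter (U i) \<le> \<delta>)}.
        \<Sum>i. ennreal (diameter (U i)))"

definition hausdorff1_outer :: "'a::metric_space set \<Rightarrow> ennreal" where
  "hausdorff1_outer A = (SUP \<delta> \<in> {0<..}. hausdorff1_content \<delta> A)"

text \<open>One-dimensional Hausdorff measure, on the Caratheodory-measurable sets. In dimension one
  the usual normalising constant is 1.\<close>

definition hausdorff1 :: "'a::metric_space measure" where
  "hausdorff1 = measure_of UNIV (lambda_system UNIV (UNIV :: 'a set set) hausdorff1_outer) hausdorff1_outer"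

text \<open>The image of Lebesgue measure under the angle parametrisation, as a measure on the Borel sets
  of the unit circle, which is its underlying space.\<close>

definition arc_length :: "(real^2) measure" where
  "arc_length = distr (restrict_space lborel {0..<2 * pi})
     (restrict_space borel (sphere 0 1)) (\<lambda>t. vector [cos t, sin t])"

definition convex_body :: "'a::euclidean_space set \<Rightarrow> bool" where
  "convex_body K \<longleftrightarrow> compact K \<and> convex K \<and> interior K \<noteq> {}"

definition origin_symmetric :: "'a::real_vector set \<Rightarrow> bool" where
  "origin_symmetric K \<longleftrightarrow> K = uminus ` K"

definition outer_unit_normal :: "'a::euclidean_space set \<Rightarrow> 'a \<Rightarrow> 'a \<Rightarrow> bool" where
  "outer_unit_normal K x v \<longleftrightarrow> norm v = 1 \<and> (\<forall>y\<in>K. (y - x) \<bullet> v \<le> 0)"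

definition inverse_gauss_image :: "'a::euclidean_space set \<Rightarrow> 'a set \<Rightarrow> 'a set" where
  "inverse_gauss_image K \<eta> = {x \<in> frontier K. \<exists>v\<in>\<eta>. outer_unit_normal K x v}"

text \<open>A measure on the Borel sets of the unit circle. Only vertices have more than one outer unit
  normal, and there are countably many of them, so the inverse Gauss images of disjoint sets overlap
  in null sets only and the set function below is countably additive.\<close>

definition gauss_surface_area_measure :: "(real^2) set \<Rightarrow> (real^2) measure" where
  "gauss_surface_area_measure K =
     measure_of (sphere 0 1) (sets (restrict_space borel (sphere 0 1)))
       (\<lambda>\<eta>. ennreal (1 / (2 * pi)) *
             (\<integral>\<^sup>+ x \<in> inverse_gauss_image K \<eta>. ennreal (exp (- (norm x)\<^sup>2 / 2)) \<partial>hausdorff1))"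

end

theory Submission
  imports Defs
begin

text \<open>Parametrise the boundary of a symmetric body by the angle \<open>t\<close> of its outer normal \<open>dir t\<close>. With
  \<open>w\<close> the radius of curvature, the boundary point \<open>x\<close> satisfies \<open>x' = w(t) dir (t + \<pi>/2)\<close> and
  \<open>x(t + \<pi>) = - x(t)\<close>, and the Gaussian surface area measure has density \<open>f\<close> exactly when
  \<open>w = g exp (|x|\<^sup>2/2)\<close> with \<open>g(t) = 2 \<pi> f(dir t)\<close>. So two antiperiodic solutions of a first-order
  system in the plane are wanted. Let \<open>c > 0\<close> be a lower bound of \<open>g\<close>.

  Enlarge the problem by a multiplier \<open>l\<close>, that is \<open>w = l g exp (|x|\<^sup>2/2)\<close>, and measure the size of a
  solution by its support value \<open>s\<close> in the direction of angle 0. Three values of \<open>s\<close> decide on which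
  side of 1 the multiplier lies:

  \<^item> \<open>s = c/2\<close> forces \<open>l < 1\<close>, because every support value is at least \<open>l c\<close>;

  \<^item> \<open>s = 4/5\<close> forces \<open>l > 1\<close>: half of the boundary then has Gaussian length at least \<open>sqrt (\<pi>/2)\<close>
    (\<open>half_gauss_length_lower_bounds\<close>, \<open>separation_numeric\<close>), whereas the hypothesis on the norm of \<open>f\<close>
    says that the integral of \<open>g\<close> over a half turn is smaller than \<open>sqrt (\<pi>/2)\<close>;

  \<^item> \<open>s = 12/c\<close> forces \<open>l < 1\<close>, because for \<open>l \<ge> 1\<close> every solution of at most this size lies in the
    disc of radius \<open>11/c\<close> (\<open>a_priori_bound\<close>).

  Now take the starting point, the multiplier and the size as three unknowns. Brouwer's fixed point
  theorem (\<open>shooting\<close>) gives a solution with \<open>s\<close> between \<open>c/2\<close> and \<open>4/5\<close> and another one with \<open>s\<close>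
  between \<open>4/5\<close> and \<open>12/c\<close>, where the update of \<open>s\<close> moves in the direction of \<open>1 - l\<close> in the first
  case and of \<open>l - 1\<close> in the second. In both cases the endpoints are pushed inwards, so \<open>s\<close> is interior
  and therefore \<open>l = 1\<close>. The two solutions have sizes on different sides of \<open>4/5\<close>
  (\<open>two_radius_functions\<close>).

  It remains to read off the measure. The curve bounds the intersection of its supporting half planes
  and has exactly one point with each normal (\<open>inverse_gauss_image_body\<close>). Borel sets are measurable
  for Hausdorff measure by Caratheodory's criterion (\<open>closed_in_lambda_system\<close>), and the Hausdorff
  measure of an arc is the integral of \<open>w\<close> over its normal angles (\<open>emeasure_arc\<close>). Hence
  integrals over inverse Gauss images become integrals over angles, in which \<open>w\<close> cancels the Gaussian
  weight (\<open>nn_integral_inverse_gauss_image\<close>, \<open>gauss_surface_area_measure_body\<close>).\<close>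

section \<open>A rotating orthonormal frame\<close>

definition dir :: "real \<Rightarrow> real^2" where
  "dir t = vector [cos t, sin t]"

lemma inner_dir: "dir s \<bullet> dir t = cos (s - t)"
  by (simp add: dir_def inner_vec_def sum_2 cos_diff)

lemma norm_dir [simp]: "norm (dir t) = 1"
  by (simp add: norm_eq_sqrt_inner inner_dir)

lemma dir_add_pi: "dir (t + pi) = - dir t"
  by (simp add: dir_def vec_eq_iff forall_2)

lemma continuous_on_dir [continuous_intros]:
  fixes f :: "'a::t2_space \<Rightarrow> real"
  shows "continuous_on S f \<Longrightarrow> continuous_on S (\<lambda>t. dir (f t))"
proof -
  assume f: "continuous_on S f"
  have eq: "(\<lambda>t. dir (f t)) = (\<lambda>t. \<chi> i. if i = 1 then cos (f t) else sin (f t))"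
    by (auto simp: dir_def vec_eq_iff forall_2 fun_eq_iff)
  have "continuous_on S (\<lambda>t. if i = 1 then cos (f t) else sin (f t))" for i :: 2
    using f by (cases "i = 1") (simp_all add: continuous_on_cos continuous_on_sin)
  then have "continuous_on S (\<lambda>t. \<chi> i::2. if i = 1 then cos (f t) else sin (f t))"
    by (rule continuous_on_vec_lambda)
  then show ?thesis by (simp only: eq)
qed

lemma borel_measurable_dir [measurable]: "dir \<in> borel_measurable borel"
  by (rule borel_measurable_continuous_onI) (intro continuous_intros)

lemma frame_decomposition: "y = (y \<bullet> dir t) *\<^sub>R dir t + (y \<bullet> dir (t + pi/2)) *\<^sub>R dir (t + pi/2)"
proof -
  have e: "cos (pi/2 + t) = - sin t" "sin (pi/2 + t) = cos t"
    by (simp_all add: cos_add sin_add)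
  have "(a * cos t + b * sin t) * cos t + (a * - sin t + b * cos t) * - sin t = a"
       "(a * cos t + b * sin t) * sin t + (a * - sin t + b * cos t) * cos t = b" for a b :: real
    using sin_cos_squared_add[of t] by algebra+
  then show ?thesis
    by (simp add: dir_def vec_eq_iff forall_2 inner_vec_def sum_2 cos_add sin_add)
qed

lemma norm_frame: "(norm y)\<^sup>2 = (y \<bullet> dir t)\<^sup>2 + (y \<bullet> dir (t + pi/2))\<^sup>2"
proof -
  have "(norm y)\<^sup>2 = y \<bullet> ((y \<bullet> dir t) *\<^sub>R dir t + (y \<bullet> dir (t + pi/2)) *\<^sub>R dir (t + pi/2))"
    using frame_decomposition[of y t] by (simp add: power2_norm_eq_inner)
  then show ?thesis
    by (simp add: inner_add_right power2_eq_square)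
qed

lemma norm_le_frame: "norm y \<le> \<bar>y \<bullet> dir t\<bar> + \<bar>y \<bullet> dir (t + pi/2)\<bar>"
  using norm_triangle_ineq[of "(y \<bullet> dir t) *\<^sub>R dir t" "(y \<bullet> dir (t + pi/2)) *\<^sub>R dir (t + pi/2)"]
    frame_decomposition[of y t] by simp

lemma ex_angle:
  assumes "norm v = 1" shows "\<exists>t\<in>{0..<2*pi}. v = dir t"
proof -
  have "(v$1)\<^sup>2 + (v$2)\<^sup>2 = 1"
    using assms by (simp add: norm_eq_sqrt_inner inner_vec_def sum_2 power2_eq_square)
  from sincos_total_2pi[OF this] obtain t where "0 \<le> t" "t < 2*pi" "v$1 = cos t" "v$2 = sin t" by metis
  then show ?thesis by (intro bexI[of _ t]) (auto simp: dir_def vec_eq_iff forall_2)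
qed

section \<open>Integrals of bounded Borel functions\<close>

lemma bounded_borel_integrable:
  fixes f :: "real \<Rightarrow> 'a::euclidean_space"
  assumes [measurable]: "f \<in> borel_measurable borel" and "\<And>t. norm (f t) \<le> B"
  shows "f integrable_on {a..b}" "set_integrable lborel {a..b} f"
proof -
  show s: "set_integrable lborel {a..b} f"
    unfolding set_integrable_def
  proof (rule Bochner_Integration.integrable_bound)
    show "integrable lborel (\<lambda>t. indicator {a..b} t *\<^sub>R B)"
      by (simp add: emeasure_lborel_Icc_eq)
    show "AE x in lborel. norm (indicat_real {a..b} x *\<^sub>R f x) \<le> norm (indicat_real {a..b} x *\<^sub>R B)"
      using assms(2) by (auto simp: indicator_def intro: order_trans[OF _ abs_ge_self])
  qed simp
  show "f integrable_on {a..b}"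
    using set_borel_integral_eq_integral(1)[OF s] .
qed

lemma nn_integral_bounded_Icc:
  fixes f :: "real \<Rightarrow> real"
  assumes [measurable]: "f \<in> borel_measurable borel" and f: "\<And>t. 0 \<le> f t" "\<And>t. f t \<le> C"
  shows "(\<integral>\<^sup>+t. ennreal (f t) * indicator {p..q} t \<partial>lborel) = ennreal (integral {p..q} f)"
proof -
  have si: "set_integrable lborel {p..q} f" by (rule bounded_borel_integrable[where B = C]) (use f in auto)
  have "(\<integral>\<^sup>+t. ennreal (f t) * indicator {p..q} t \<partial>lborel) = (\<integral>\<^sup>+t. ennreal (indicator {p..q} t *\<^sub>R f t) \<partial>lborel)"
    by (rule nn_integral_cong) (auto simp: indicator_def)
  also have "\<dots> = ennreal (LINT t|lborel. indicator {p..q} t *\<^sub>R f t)"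
    using si f unfolding set_integrable_def by (intro nn_integral_eq_integral) auto
  also have "\<dots> = ennreal (integral {p..q} f)"
    using set_borel_integral_eq_integral(2)[OF si] by (simp add: set_lebesgue_integral_def)
  finally show ?thesis .
qed

lemma integral_shift:
  fixes f :: "real \<Rightarrow> 'a::euclidean_space"
  shows "integral {a + c..b + c} f = integral {a..b} (\<lambda>t. f (t + c))"
proof -
  have "(f has_integral y) {a + c..b + c} \<longleftrightarrow> ((\<lambda>t. f (t + c)) has_integral y) {a..b}" for y
    using has_integral_affinity_iff[of 1 f c y "a+c" "b+c"] by simp
  then show ?thesis by (simp add: integral_def integrable_on_def)
qed

section \<open>A chain rule for Lipschitz primitives\<close>

text \<open>The derivative vanishes at every point. This is the tool that turns second-order agreement of two
  quantities attached to short intervals into equality on long ones, for the chain rule below and for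
  the Hausdorff measure of arcs.\<close>

lemma constant_if_quadratic_increments:
  fixes D :: "real \<Rightarrow> real"
  assumes "a \<le> b" and inc: "\<And>s t. a \<le> s \<Longrightarrow> s \<le> t \<Longrightarrow> t \<le> b \<Longrightarrow> \<bar>D t - D s\<bar> \<le> C * (t - s)\<^sup>2"
  shows "D b = D a"
proof -
  have inc': "\<bar>D t - D s\<bar> \<le> \<bar>C\<bar> * (t - s)\<^sup>2" if "s \<in> {a..b}" "t \<in> {a..b}" for s t
  proof -
    have "C * (t-s)\<^sup>2 \<le> \<bar>C\<bar> * (t - s)\<^sup>2" "C * (s-t)\<^sup>2 \<le> \<bar>C\<bar> * (t - s)\<^sup>2" 
      by (auto intro!: mult_right_mono simp: power2_commute)
    then show ?thesis using inc[of s t] inc[of t s] that by (cases "s \<le> t") auto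
  qed
  have "(D has_derivative (\<lambda>_. 0)) (at s within {a..b})" if s: "s \<in> {a..b}" for s
    unfolding has_derivative_within
  proof (intro conjI)
    show "((\<lambda>y. (1 / norm (y - s)) *\<^sub>R (D y - (D s + 0))) \<longlongrightarrow> 0) (at s within {a..b})"
    proof (rule Lim_null_comparison)
      show "\<forall>\<^sub>F y in at s within {a..b}. norm ((1 / norm (y - s)) *\<^sub>R (D y - (D s + 0))) \<le> \<bar>C\<bar> * \<bar>y - s\<bar>"
        unfolding eventually_at_filter
      proof (rule always_eventually, intro allI impI)
        fix y assume "y \<noteq> s" "y \<in> {a..b}"
        then show "norm ((1 / norm (y - s)) *\<^sub>R (D y - (D s + 0))) \<le> \<bar>C\<bar> * \<bar>y - s\<bar>"
          using inc'[OF s, of y] by (simp add: pos_divide_le_eq mult.assoc flip: power2_eq_square)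
      qed
      have "((\<lambda>y. \<bar>C\<bar> * \<bar>y - s\<bar>) \<longlongrightarrow> \<bar>C\<bar> * \<bar>s - s\<bar>) (at s within {a..b})"
        by (intro tendsto_intros)
      then show "((\<lambda>y. \<bar>C\<bar> * \<bar>y - s\<bar>) \<longlongrightarrow> 0) (at s within {a..b})" by simp
    qed
  qed simp
  then obtain c where "\<forall>x\<in>{a..b}. D x = c"
    using has_derivative_zero_constant[of "{a..b}" D] by (metis convex_real_interval(5))
  then show ?thesis using \<open>a \<le> b\<close> by simp
qed

text \<open>Here \<open>y\<close> is merely the primitive of a bounded measurable function and may fail to be differentiable
  at some points. Both sides of the claim change by \<open>F' (y s) * (y t - y s)\<close> on a short interval, up
  to an error of second order.\<close>

lemma chain_rule_primitive:
  fixes y v F F' :: "real \<Rightarrow> real"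
  assumes y: "\<And>s t. a \<le> s \<Longrightarrow> s \<le> t \<Longrightarrow> t \<le> b \<Longrightarrow> y t - y s = integral {s..t} v"
    and v [measurable]: "v \<in> borel_measurable borel" and vB: "\<And>t. \<bar>v t\<bar> \<le> B"
    and F: "\<And>z. (F has_real_derivative F' z) (at z)"
    and K: "\<And>z z'. \<bar>F' z - F' z'\<bar> \<le> K * \<bar>z - z'\<bar>"
    and ab: "a \<le> b" and int: "(\<lambda>r. F' (y r) * v r) integrable_on {a..b}"
  shows "F (y b) - F (y a) = integral {a..b} (\<lambda>r. F' (y r) * v r)"
proof -
  have iv: "v integrable_on {s..t}" for s t
    by (rule bounded_borel_integrable[where B = B]) (use vB in auto)
  have B0: "0 \<le> B" using vB[of 0] by simp
  have K0: "0 \<le> K" using K[of 1 0] by simp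
  have yl: "\<bar>y t - y s\<bar> \<le> B * (t - s)" if "a \<le> s" "s \<le> t" "t \<le> b" for s t
  proof -
    have "norm (integral (cbox s t) v) \<le> B * measure lborel (cbox s t)"
      using vB by (intro has_integral_bound[OF B0 integrable_integral]) (use iv in auto)
    then show ?thesis using y[OF that] that by simp
  qed
  define D where "D t = F (y t) - integral {a..t} (\<lambda>r. F' (y r) * v r)" for t
  have "\<bar>D t - D s\<bar> \<le> (K * B\<^sup>2 * 2) * (t - s)\<^sup>2" if st: "a \<le> s" "s \<le> t" "t \<le> b" for s t
  proof -
    let ?f = "\<lambda>r. F' (y r) * v r"
    have intst: "?f integrable_on {s..t}" and intat: "?f integrable_on {a..t}"
      by (rule integrable_subinterval_real[OF int]; use st in auto)+
    have "integral {a..s} ?f + integral {s..t} ?f = integral {a..t} ?f"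
      by (rule Henstock_Kurzweil_Integration.integral_combine) (use st intat in auto)
    moreover have mvt: "\<bar>F (y t) - F (y s) - F' (y s) * (y t - y s)\<bar> \<le> K * B\<^sup>2 * (t - s)\<^sup>2"
    proof -
      obtain z where z: "\<bar>z - y s\<bar> \<le> \<bar>y t - y s\<bar>" "F (y t) - F (y s) = (y t - y s) * F' z"
      proof (cases "y s" "y t" rule: linorder_cases)
        case less
        from MVT2[OF less, of F F'] F that obtain z where "y s < z" "z < y t" "F (y t) - F (y s) = (y t - y s) * F' z" by blast
        then show ?thesis by (intro that[of z]) auto
      next
        case greater
        from MVT2[OF greater, of F F'] F obtain z where "y t < z" "z < y s" "F (y s) - F (y t) = (y s - y t) * F' z" by blast
        then show ?thesis by (intro that[of z]) (auto simp: algebra_simps)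
      qed (use that in auto)
      have "\<bar>F (y t) - F (y s) - F' (y s) * (y t - y s)\<bar> = \<bar>F' z - F' (y s)\<bar> * \<bar>y t - y s\<bar>"
        unfolding z(2) by (simp add: abs_mult[symmetric] algebra_simps)
      also have "\<dots> \<le> K * \<bar>y t - y s\<bar> * \<bar>y t - y s\<bar>"
        using K[of z "y s"] z(1) K0 by (intro mult_right_mono) (auto intro: order_trans mult_left_mono)
      also have "\<dots> \<le> K * (B * (t - s)) * (B * (t - s))"
        using yl[OF st] K0 B0 st by (intro mult_mono) auto
      finally show ?thesis by (simp add: power2_eq_square algebra_simps)
    qed
    moreover have "\<bar>integral {s..t} ?f - F' (y s) * (y t - y s)\<bar> \<le> K * B\<^sup>2 * (t - s)\<^sup>2"
    proof -
      have "integral {s..t} ?f - F' (y s) * (y t - y s) = integral {s..t} (\<lambda>r. (F' (y r) - F' (y s)) * v r)"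
        unfolding y[OF st]
        using integrable_on_mult_right[OF iv[of s t], of "F' (y s)"]
        by (simp add: left_diff_distrib integral_diff[OF intst] flip: integral_mult_right)
      moreover have "norm (integral (cbox s t) (\<lambda>r. (F' (y r) - F' (y s)) * v r)) \<le> (K * B * (t - s) * B) * measure lborel (cbox s t)"
      proof (rule has_integral_bound[OF _ integrable_integral])
        show "(\<lambda>r. (F' (y r) - F' (y s)) * v r) integrable_on cbox s t"
          using intst iv by (auto simp: left_diff_distrib intro!: integrable_diff integrable_on_mult_right)
        fix r assume r: "r \<in> cbox s t"
        have "\<bar>F' (y r) - F' (y s)\<bar> \<le> K * (B * (t - s))"
          using K[of "y r" "y s"] yl[of s r] r st K0 B0
          by (smt (verit, best) cbox_interval atLeastAtMost_iff mult_left_mono)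
        then show "norm ((F' (y r) - F' (y s)) * v r) \<le> K * B * (t - s) * B"
          using mult_mono[OF _ vB[of r], of "\<bar>F' (y r) - F' (y s)\<bar>" "K * (B * (t - s))"] K0 B0 st by (simp add: abs_mult mult_ac)
      qed (use K0 B0 st in auto)
      ultimately show ?thesis using st by (simp add: power2_eq_square algebra_simps)
    qed
    ultimately show ?thesis unfolding D_def by linarith
  qed
  then have "D b = D a" by (rule constant_if_quadratic_increments[OF ab]) 
  then show ?thesis by (simp add: D_def)
qed

section \<open>Caratheodory differential equations\<close>

lemma integral_exp: 
  fixes k :: real assumes "k > 0" "0 \<le> t"
  shows "(\<lambda>s. exp (k * s)) integrable_on {0..t}" "integral {0..t} (\<lambda>s. exp (k * s)) = (exp (k * t) - 1) / k"
proof -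
  have "((\<lambda>s. exp (k * s)) has_integral (exp (k * t) / k - exp (k * 0) / k)) {0..t}"
    using assms by (intro fundamental_theorem_of_calculus)
      (auto intro!: derivative_eq_intros simp flip: has_real_derivative_iff_has_vector_derivative)
  then show "(\<lambda>s. exp (k * s)) integrable_on {0..t}" "integral {0..t} (\<lambda>s. exp (k * s)) = (exp (k * t) - 1) / k"
    by (auto simp: diff_divide_distrib dest: integral_unique)
qed

text \<open>Picard iteration for a right-hand side that is measurable in time and Lipschitz in space, together with
  Lipschitz dependence of the end point on the initial value \<open>p\<close> and the multiplier \<open>l\<close>. The unknown
  is \<open>exp (- k t) (X t - p)\<close> in the space of bounded continuous functions; the weight makes the
  integral operator a contraction for large \<open>k\<close> without shortening the time interval, and the
  same estimate for two different parameters yields the dependence on them.\<close>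

lemma caratheodory_flow:
  fixes A :: "real \<Rightarrow> 'a::euclidean_space" and E :: "'a \<Rightarrow> real"
  assumes A [measurable]: "A \<in> borel_measurable borel" and AG: "\<And>t. norm (A t) \<le> G"
    and EM: "\<And>x. \<bar>E x\<bar> \<le> M" and EK: "\<And>x y. \<bar>E x - E y\<bar> \<le> K * norm (x - y)"
    and T: "0 \<le> T" and \<Lambda>: "0 \<le> \<Lambda>"
  shows "\<exists>X :: 'a \<Rightarrow> real \<Rightarrow> real \<Rightarrow> 'a. \<exists>C.
     (\<forall>p l. continuous_on UNIV (X p l)) \<and>
     (\<forall>p l t. \<bar>l\<bar> \<le> \<Lambda> \<longrightarrow> 0 \<le> t \<longrightarrow> t \<le> T \<longrightarrow> X p l t = p + integral {0..t} (\<lambda>s. (l * E (X p l s)) *\<^sub>R A s)) \<and>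
     (\<forall>p q l m. \<bar>l\<bar> \<le> \<Lambda> \<longrightarrow> \<bar>m\<bar> \<le> \<Lambda> \<longrightarrow> norm (X p l T - X q m T) \<le> C * (norm (p - q) + \<bar>l - m\<bar>))"
proof -
  have G0: "0 \<le> G" using AG[of 0] norm_ge_zero order_trans by blast
  have M0: "0 \<le> M" using EM[of 0] by linarith
  have K0: "0 \<le> K"
  proof -
    obtain b :: 'a where "b \<in> Basis" using nonempty_Basis by blast
    then show ?thesis using EK[of b 0] by simp
  qed
  have "K-lipschitz_on UNIV E"
    by (rule lipschitz_onI) (simp_all add: dist_norm EK K0)
  then have contE: "continuous_on UNIV E" by (rule lipschitz_on_continuous_on)
  then have [measurable]: "E \<in> borel_measurable borel" by (rule borel_measurable_continuous_onI)
  (* The contraction factor is \<Lambda> * K * G / k, and k is chosen to make it at most 1/2. *)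
  define k where "k = 2 * (\<Lambda> * K * G) + 1"
  have k0: "k > 0" using \<Lambda> K0 G0 by (auto simp: k_def intro!: add_nonneg_pos)
  define f where "f p l Y s = (l * E (p + exp (k * s) *\<^sub>R apply_bcontfun Y s)) *\<^sub>R A s" for p l and Y :: "real \<Rightarrow>\<^sub>C 'a" and s
  (* Bounded continuous functions live on the whole line, so time is clamped to the interval. *)
  define cl where "cl t = max 0 (min T t)" for t
  have cl: "0 \<le> cl t" "cl t \<le> T" for t using T by (auto simp: cl_def)
  have fm [measurable]: "f p l Y \<in> borel_measurable borel" for p l Y
  proof -
    have [measurable]: "apply_bcontfun Y \<in> borel_measurable borel"
      by (rule borel_measurable_continuous_onI) simp
    show ?thesis unfolding f_def by measurable
  qed
  have fB: "norm (f p l Y s) \<le> \<bar>l\<bar> * M * G" for p l Y s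
    unfolding f_def by (auto simp: abs_mult intro!: mult_mono EM AG mult_nonneg_nonneg M0)
  have fi: "f p l Y integrable_on {a..b}" for p l Y a b
    by (rule bounded_borel_integrable[OF _ fB]) simp
  define N where "N p l Y t = exp (- k * cl t) *\<^sub>R integral {0..cl t} (f p l Y)" for p l Y t
  have Nb: "N p l Y \<in> bcontfun" for p l Y
    unfolding bcontfun_def
  proof (intro CollectI conjI)
    have "continuous_on {0..T} (\<lambda>t. integral {0..t} (f p l Y))"
      by (rule indefinite_integral_continuous_1[OF fi])
    moreover have "continuous_on UNIV cl" unfolding cl_def by (intro continuous_intros)
    ultimately have "continuous_on UNIV (\<lambda>t. integral {0..cl t} (f p l Y))"
      by (rule continuous_on_compose2) (use cl in auto)
    then show "continuous_on UNIV (N p l Y)"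
      unfolding N_def cl_def by (intro continuous_intros)
    have "norm (N p l Y t) \<le> 1 * ((\<bar>l\<bar> * M * G) * T)" for t
    proof -
      have "norm (integral (cbox 0 (cl t)) (f p l Y)) \<le> (\<bar>l\<bar> * M * G) * measure lborel (cbox 0 (cl t))"
        using fB M0 G0 by (intro has_integral_bound[OF _ integrable_integral]) (auto simp: fi)
      also have "\<dots> \<le> (\<bar>l\<bar> * M * G) * T" using cl[of t] M0 G0 by (intro mult_left_mono) auto
      finally show ?thesis
        unfolding N_def norm_scaleR using cl[of t] k0 by (intro mult_mono) auto
    qed
    then show "bounded (range (N p l Y))" by (auto simp: bounded_iff)
  qed
  define NC where "NC p l Y = Bcontfun (N p l Y)" for p l Y
  have NC [simp]: "apply_bcontfun (NC p l Y) t = N p l Y t" for p l Y t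
    unfolding NC_def by (simp add: Bcontfun_inverse[OF Nb])
  define C where "C = G * T * (\<Lambda> * K + M)"
  have C0: "0 \<le> C" using G0 T \<Lambda> K0 M0 by (auto simp: C_def)
  have est: "dist (NC p l Y) (NC q m Z) \<le> 1/2 * dist Y Z + C * (norm (p - q) + \<bar>l - m\<bar>)"
    if l: "\<bar>l\<bar> \<le> \<Lambda>" and m: "\<bar>m\<bar> \<le> \<Lambda>" for p q l m Y Z
  proof (rule dist_bound)
    fix t
    let ?\<tau> = "cl t" and ?\<delta> = "dist Y Z"
    define c where "c = G * (\<Lambda> * K * norm (p - q) + M * \<bar>l - m\<bar>)"
    have c0: "0 \<le> c" using G0 \<Lambda> K0 M0 by (auto simp: c_def)
    have pw: "norm (f p l Y s - f q m Z s) \<le> (\<Lambda> * K * G * ?\<delta>) * exp (k * s) + c" for s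
    proof -
      let ?x = "p + exp (k * s) *\<^sub>R apply_bcontfun Y s" and ?y = "q + exp (k * s) *\<^sub>R apply_bcontfun Z s"
      have "norm (?x - ?y) = norm ((p - q) + exp (k * s) *\<^sub>R (apply_bcontfun Y s - apply_bcontfun Z s))"
        by (simp add: algebra_simps)
      also have "\<dots> \<le> norm (p - q) + exp (k * s) * ?\<delta>"
        using dist_bounded[of Y s Z] by (intro norm_triangle_le) (auto simp: dist_norm)
      finally have xy: "norm (?x - ?y) \<le> norm (p - q) + exp (k * s) * ?\<delta>" .
      have "\<bar>l * E ?x - m * E ?y\<bar> = \<bar>l * (E ?x - E ?y) + (l - m) * E ?y\<bar>" by (simp add: algebra_simps)
      also have "\<dots> \<le> \<bar>l\<bar> * \<bar>E ?x - E ?y\<bar> + \<bar>l - m\<bar> * \<bar>E ?y\<bar>" by (metis abs_mult abs_triangle_ineq)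
      also have "\<dots> \<le> \<Lambda> * (K * norm (?x - ?y)) + \<bar>l - m\<bar> * M"
        using l \<Lambda> EK EM by (intro add_mono mult_mono) auto
      also have "\<dots> \<le> \<Lambda> * (K * (norm (p - q) + exp (k * s) * ?\<delta>)) + \<bar>l - m\<bar> * M"
        using xy \<Lambda> K0 by (intro add_mono mult_left_mono) auto
      finally have d: "\<bar>l * E ?x - m * E ?y\<bar> \<le> \<Lambda> * (K * (norm (p - q) + exp (k * s) * ?\<delta>)) + \<bar>l - m\<bar> * M" .
      have "norm (f p l Y s - f q m Z s) = \<bar>l * E ?x - m * E ?y\<bar> * norm (A s)"
        unfolding f_def by (simp flip: scaleR_diff_left)
      also have "\<dots> \<le> (\<Lambda> * (K * (norm (p - q) + exp (k * s) * ?\<delta>)) + \<bar>l - m\<bar> * M) * G"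
        using d AG[of s] by (intro mult_mono) (use \<Lambda> K0 M0 in auto)
      finally show ?thesis by (simp add: c_def algebra_simps)
    qed
    have ie: "((\<lambda>s. (\<Lambda> * K * G * ?\<delta>) * exp (k * s) + c) has_integral (\<Lambda> * K * G * ?\<delta>) * ((exp (k * ?\<tau>) - 1) / k) + ?\<tau> * c) {0..?\<tau>}"
    proof (rule has_integral_add)
      show "((\<lambda>s. (\<Lambda> * K * G * ?\<delta>) * exp (k * s)) has_integral (\<Lambda> * K * G * ?\<delta>) * ((exp (k * ?\<tau>) - 1) / k)) {0..?\<tau>}"
        using integral_exp[OF k0 cl(1)[of t]] by (intro has_integral_mult_right) (auto simp: has_integral_iff)
      show "((\<lambda>s. c) has_integral ?\<tau> * c) {0..?\<tau>}"
        using has_integral_const_real[of c 0 ?\<tau>] cl(1)[of t] by simp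
    qed
    have "norm (integral {0..?\<tau>} (f p l Y) - integral {0..?\<tau>} (f q m Z)) = norm (integral {0..?\<tau>} (\<lambda>s. f p l Y s - f q m Z s))"
      by (simp add: integral_diff fi)
    also have "\<dots> \<le> (\<Lambda> * K * G * ?\<delta>) * ((exp (k * ?\<tau>) - 1) / k) + ?\<tau> * c"
      using integral_norm_bound_integral[OF integrable_diff[OF fi fi] has_integral_integrable[OF ie] pw]
      by (simp add: integral_unique[OF ie])
    finally have "dist (N p l Y t) (N q m Z t) \<le> exp (- k * ?\<tau>) * ((\<Lambda> * K * G * ?\<delta>) * ((exp (k * ?\<tau>) - 1) / k) + ?\<tau> * c)"
      unfolding N_def dist_norm by (simp flip: scaleR_diff_right)
    also have "\<dots> = (\<Lambda> * K * G / k) * ?\<delta> * (1 - exp (- k * ?\<tau>)) + exp (- k * ?\<tau>) * (?\<tau> * c)"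
      using k0 by (simp add: field_simps exp_minus)
    also have "\<dots> \<le> (1/2) * ?\<delta> * 1 + 1 * (T * c)"
    proof (intro add_mono mult_mono)
      show "\<Lambda> * K * G / k \<le> 1 / 2" using k0 by (simp add: k_def divide_simps)
    qed (use c0 cl[of t] k0 \<Lambda> K0 G0 T in auto)
    also have "T * c \<le> C * (norm (p - q) + \<bar>l - m\<bar>)"
    proof -
      have "C * (norm (p - q) + \<bar>l - m\<bar>) - T * c = G * T * (M * norm (p - q) + \<Lambda> * K * \<bar>l - m\<bar>)"
        by (simp add: C_def c_def algebra_simps)
      also have "\<dots> \<ge> 0" using G0 T \<Lambda> K0 M0 by auto
      finally show ?thesis by linarith
    qed
    finally show "dist (apply_bcontfun (NC p l Y) t) (apply_bcontfun (NC q m Z) t) \<le> 1/2 * dist Y Z + C * (norm (p - q) + \<bar>l - m\<bar>)"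
      by simp
  qed
  have "\<exists>Y. NC p l Y = Y" if "\<bar>l\<bar> \<le> \<Lambda>" for p l
    using banach_fix_type[of "1/2" "NC p l"] est[OF that that, of p _ p] by auto
  then have Y: "NC p l (SOME Y. NC p l Y = Y) = (SOME Y. NC p l Y = Y)" if "\<bar>l\<bar> \<le> \<Lambda>" for p l
    using that by (metis (mono_tags, lifting) someI_ex)
  define Y where "Y p l = (SOME Y. NC p l Y = Y)" for p l
  note Y = Y[folded Y_def]
  define X where "X p l t = p + exp (k * t) *\<^sub>R apply_bcontfun (Y p l) t" for p l t
  have "continuous_on UNIV (X p l)" for p l
    unfolding X_def by (intro continuous_intros) simp
  moreover have "X p l t = p + integral {0..t} (\<lambda>s. (l * E (X p l s)) *\<^sub>R A s)"
    if "\<bar>l\<bar> \<le> \<Lambda>" "0 \<le> t" "t \<le> T" for p l t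
  proof -
    have "apply_bcontfun (Y p l) t = N p l (Y p l) t" using Y[OF that(1)] NC by metis
    then have "X p l t = p + integral {0..t} (f p l (Y p l))"
      using that by (simp add: X_def N_def cl_def exp_minus)
    then show ?thesis by (simp add: X_def f_def [abs_def])
  qed
  moreover have "norm (X p l T - X q m T) \<le> (1 + exp (k * T) * (2 * C)) * (norm (p - q) + \<bar>l - m\<bar>)"
    if "\<bar>l\<bar> \<le> \<Lambda>" "\<bar>m\<bar> \<le> \<Lambda>" for p q l m
  proof -
    have d: "dist (Y p l) (Y q m) \<le> 2 * C * (norm (p - q) + \<bar>l - m\<bar>)"
      using est[OF that, of p "Y p l" q "Y q m"] Y that by simp
    have "norm (X p l T - X q m T) = norm ((p - q) + exp (k * T) *\<^sub>R (apply_bcontfun (Y p l) T - apply_bcontfun (Y q m) T))"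
      by (simp add: X_def algebra_simps)
    also have "\<dots> \<le> norm (p - q) + exp (k * T) * dist (Y p l) (Y q m)"
      using dist_bounded[of "Y p l" T "Y q m"] by (intro norm_triangle_le) (auto simp: dist_norm)
    also have "\<dots> \<le> (norm (p - q) + \<bar>l - m\<bar>) + exp (k * T) * (2 * C * (norm (p - q) + \<bar>l - m\<bar>))"
      using d by (intro add_mono mult_left_mono) auto
    finally show ?thesis by (simp add: algebra_simps)
  qed
  ultimately show ?thesis by blast
qed

section \<open>The primitive of the Gaussian weight\<close>

definition gauss_primitive :: "real \<Rightarrow> real" where
  "gauss_primitive z = (LBINT y=0..z. exp (- y\<^sup>2 / 2))"

lemma gauss_primitive_deriv: "(gauss_primitive has_real_derivative exp (- z\<^sup>2 / 2)) (at z)"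
proof -
  define a b where "a = min z 0 - 1" and "b = max z 0 + 1"
  have *: "((\<lambda>z. LBINT y=0..z. exp (- y\<^sup>2 / 2)) has_vector_derivative exp (- z\<^sup>2 / 2)) (at z within {a..b})"
    unfolding zero_ereal_def
    by (rule interval_integral_FTC2) (auto simp: a_def b_def intro!: continuous_intros)
  have "at z within {a..b} = at z"
    by (rule at_within_interior) (auto simp: interior_atLeastAtMost_real a_def b_def)
  with * show ?thesis
    unfolding has_real_derivative_iff_has_vector_derivative gauss_primitive_def [abs_def] by simp
qed

lemma gauss_primitive_0 [simp]: "gauss_primitive 0 = 0"
  by (simp add: gauss_primitive_def zero_ereal_def)

lemma gauss_primitive_minus: "gauss_primitive (- z) = - gauss_primitive z"
proof -
  have "((\<lambda>z. gauss_primitive z + gauss_primitive (- z)) has_real_derivative 0) (at z)" for z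
    by (auto intro!: derivative_eq_intros DERIV_chain2[where f = gauss_primitive] gauss_primitive_deriv)
  then have "gauss_primitive z + gauss_primitive (- z) = gauss_primitive 0 + gauss_primitive (- 0)"
    using DERIV_const_ratio_const DERIV_isconst_all by blast
  then show ?thesis by simp
qed

lemma gauss_primitive_mono: "a \<le> b \<Longrightarrow> gauss_primitive a \<le> gauss_primitive b"
  by (rule DERIV_nonneg_imp_nondecreasing) (use gauss_primitive_deriv in force)+

lemma gauss_primitive_ge: "0 \<le> z \<Longrightarrow> z - z ^ 3 / 6 \<le> gauss_primitive z"
proof -
  assume "0 \<le> z"
  have "(\<lambda>z. gauss_primitive z - (z - z ^ 3 / 6)) 0 \<le> (\<lambda>z. gauss_primitive z - (z - z ^ 3 / 6)) z"
  proof (rule DERIV_nonneg_imp_nondecreasing[OF \<open>0 \<le> z\<close>])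
    fix x :: real
    have "((\<lambda>z. gauss_primitive z - (z - z ^ 3 / 6)) has_real_derivative exp (- x\<^sup>2 / 2) - (1 - x\<^sup>2 / 2)) (at x)"
      by (auto intro!: derivative_eq_intros gauss_primitive_deriv)
    moreover have "0 \<le> exp (- x\<^sup>2 / 2) - (1 - x\<^sup>2 / 2)"
      using exp_ge_add_one_self[of "- x\<^sup>2 / 2"] by simp
    ultimately show "\<exists>y. ((\<lambda>z. gauss_primitive z - (z - z ^ 3 / 6)) has_real_derivative y) (at x) \<and> 0 \<le> y" by blast
  qed
  then show ?thesis by simp
qed

lemma gauss_density_lipschitz: "\<bar>exp (- a\<^sup>2 / 2) - exp (- b\<^sup>2 / 2)\<bar> \<le> 1 * \<bar>a - b\<bar>" for a b :: real
proof -
  have "norm (exp (- a\<^sup>2 / 2) - exp (- b\<^sup>2 / 2)) \<le> 1 * norm (a - b)"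
  proof (rule field_differentiable_bound[of UNIV])
    fix z :: real
    show "((\<lambda>z. exp (- z\<^sup>2 / 2)) has_field_derivative - z * exp (- z\<^sup>2 / 2)) (at z within UNIV)"
      by (auto intro!: derivative_eq_intros)
    have "\<bar>z\<bar> \<le> 1 + z\<^sup>2 / 2"
      using zero_le_power2[of "\<bar>z\<bar> - 1"] by (simp add: power2_diff)
    also have "\<dots> \<le> exp (z\<^sup>2 / 2)" by (rule exp_ge_add_one_self)
    finally show "norm (- z * exp (- z\<^sup>2 / 2)) \<le> 1"
      by (simp add: abs_mult exp_minus divide_simps)
  qed auto
  then show ?thesis by simp
qed

section \<open>Centrally symmetric curves with a given radius of curvature\<close>

locale radius_function =
  fixes w :: "real \<Rightarrow> real" and B :: real
  assumes w_borel [measurable]: "w \<in> borel_measurable borel"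
    and w_nonneg: "\<And>t. 0 \<le> w t" and w_le: "\<And>t. w t \<le> B" and w_periodic: "\<And>t. w (t + pi) = w t"
begin

text \<open>The point of the boundary with outer normal \<open>dir t\<close>. Since \<open>w\<close> has period \<open>\<pi>\<close>, the velocity
  \<open>w s *\<^sub>R dir (s + pi/2)\<close> changes sign after a half turn, and this choice of the integration
  constant is the only one that makes the curve symmetric about the origin.\<close>

definition curve :: "real \<Rightarrow> real^2" where
  "curve t = - (1/2) *\<^sub>R integral {t..t + pi} (\<lambda>s. w s *\<^sub>R dir (s + pi/2))"

text \<open>The support function of the region bounded by the curve.\<close>

definition support :: "real \<Rightarrow> real" where "support t = curve t \<bullet> dir t"

lemma B_nonneg: "0 \<le> B" using w_nonneg[of 0] w_le[of 0] by linarith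

lemma integrable_w_dir: "(\<lambda>s. w s *\<^sub>R dir (s + pi/2)) integrable_on {a..b}"
  by (rule bounded_borel_integrable[where B = B]) (auto simp: w_nonneg w_le)

lemma integrable_w_mult:
  assumes [measurable]: "\<phi> \<in> borel_measurable borel" and "\<And>t. \<bar>\<phi> t\<bar> \<le> C"
  shows "(\<lambda>s. w s * \<phi> s) integrable_on {a..b}"
  by (rule bounded_borel_integrable[where B = "B * C"])
    (auto simp: abs_mult w_nonneg w_le B_nonneg intro!: mult_mono assms(2))

lemma integrable_w: "w integrable_on {a..b}"
  using integrable_w_mult[of "\<lambda>_. 1" 1] by simp

lemma curve_add_pi: "curve (t + pi) = - curve t"
proof -
  have "dir (s + pi + pi/2) = - dir (s + pi/2)" for s
    using dir_add_pi[of "s + pi/2"] by (simp add: algebra_simps)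
  then have "integral {t + pi..t + pi + pi} (\<lambda>s. w s *\<^sub>R dir (s + pi/2)) = - integral {t..t + pi} (\<lambda>s. w s *\<^sub>R dir (s + pi/2))"
    by (simp only: integral_shift w_periodic scaleR_minus_right integral_neg)
  then show ?thesis by (simp add: curve_def)
qed

lemma curve_diff:
  assumes "a \<le> b"
  shows "curve b - curve a = integral {a..b} (\<lambda>s. w s *\<^sub>R dir (s + pi/2))"
proof -
  let ?I = "\<lambda>a b. integral {a..b} (\<lambda>s. w s *\<^sub>R dir (s + pi/2))"
  have "dir (s + pi + pi/2) = - dir (s + pi/2)" for s
    using dir_add_pi[of "s + pi/2"] by (simp add: algebra_simps)
  then have 1: "?I (a + pi) (b + pi) = - ?I a b"
    by (simp only: integral_shift w_periodic scaleR_minus_right integral_neg)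
  have 2: "?I a b + ?I b (b + pi) = ?I a (b + pi)" "?I a (a + pi) + ?I (a + pi) (b + pi) = ?I a (b + pi)"
    using assms by (auto intro!: Henstock_Kurzweil_Integration.integral_combine integrable_w_dir)
  have "?I b (b + pi) = ?I a (a + pi) - 2 *\<^sub>R ?I a b"
    using 1 2 by (simp add: algebra_simps scaleR_2)
  then show ?thesis by (simp add: curve_def scaleR_diff_right)
qed

lemma curve_diff_inner:
  assumes "a \<le> b"
  shows "(curve b - curve a) \<bullet> dir \<theta> = - integral {a..b} (\<lambda>s. w s * sin (s - \<theta>))"
    and "(curve b - curve a) \<bullet> dir (\<theta> + pi/2) = integral {a..b} (\<lambda>s. w s * cos (s - \<theta>))"
proof -
  have *: "(curve b - curve a) \<bullet> v = integral {a..b} (\<lambda>s. w s * (dir (s + pi/2) \<bullet> v))" for v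
    unfolding curve_diff[OF assms]
    using integral_linear[OF integrable_w_dir bounded_linear_inner_left[of v], of a b] by (simp add: o_def)
  have "cos (s + pi/2 - \<theta>) = - sin (s - \<theta>)" "cos (s + pi/2 - (\<theta> + pi/2)) = cos (s - \<theta>)" for s
    by (simp_all add: cos_add cos_diff sin_diff sin_add)
  then show "(curve b - curve a) \<bullet> dir \<theta> = - integral {a..b} (\<lambda>s. w s * sin (s - \<theta>))"
    and "(curve b - curve a) \<bullet> dir (\<theta> + pi/2) = integral {a..b} (\<lambda>s. w s * cos (s - \<theta>))"
    unfolding * by (simp_all add: inner_dir)
qed

lemma two_support: "2 * support \<theta> = integral {\<theta>..\<theta> + pi} (\<lambda>s. w s * sin (s - \<theta>))"
  using curve_diff_inner(1)[of \<theta> "\<theta> + pi" \<theta>]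
  unfolding curve_add_pi support_def inner_diff_left inner_minus_left by simp

lemma norm_curve_diff:
  assumes "a \<le> b" shows "norm (curve b - curve a) \<le> B * (b - a)"
proof -
  have "norm (integral (cbox a b) (\<lambda>s. w s *\<^sub>R dir (s + pi/2))) \<le> B * measure lborel (cbox a b)"
    using B_nonneg w_nonneg w_le by (intro has_integral_bound[OF _ integrable_integral]) (auto simp: integrable_w_dir)
  then show ?thesis using assms by (simp add: curve_diff)
qed

lemma continuous_curve: "continuous_on S curve"
proof -
  have "norm (curve b - curve a) \<le> B * \<bar>b - a\<bar>" for a b
    using norm_curve_diff[of a b] norm_curve_diff[of b a] by (cases "a \<le> b") (auto simp: norm_minus_commute)
  then have "B-lipschitz_on S curve" by (intro lipschitz_onI) (auto simp: dist_norm B_nonneg)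
  then show ?thesis by (rule lipschitz_on_continuous_on)
qed

lemma curve_borel [measurable]: "curve \<in> borel_measurable borel"
  by (rule borel_measurable_continuous_onI[OF continuous_curve])

lemma continuous_support: "continuous_on S support"
  unfolding support_def by (intro continuous_intros continuous_curve)

lemma support_add_pi: "support (t + pi) = support t"
  by (simp add: support_def curve_add_pi dir_add_pi)

context
  fixes \<theta> :: real
begin

text \<open>Along the half turn that starts at \<open>\<theta>\<close> the coordinate in direction \<open>dir \<theta>\<close> decreases
  from \<open>support \<theta>\<close> to \<open>- support \<theta>\<close>.\<close>

lemma frame_coordinate_1:
  assumes "\<theta> \<le> t" "t \<le> \<theta> + pi"
  shows "\<bar>curve t \<bullet> dir \<theta>\<bar> \<le> support \<theta>"
proof -
  have sn: "0 \<le> sin (s - \<theta>)" if "\<theta> \<le> s" "s \<le> \<theta> + pi" for s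
    using that by (intro sin_ge_zero) auto
  have i: "(\<lambda>s. w s * sin (s - \<theta>)) integrable_on {a..b}" for a b
    by (rule integrable_w_mult[where C = 1]) auto
  have "0 \<le> integral {\<theta>..t} (\<lambda>s. w s * sin (s - \<theta>))" "0 \<le> integral {t..\<theta>+pi} (\<lambda>s. w s * sin (s - \<theta>))"
    using assms by (auto intro!: Henstock_Kurzweil_Integration.integral_nonneg i mult_nonneg_nonneg w_nonneg sn)
  then show ?thesis
    using curve_diff_inner(1)[OF assms(1), of \<theta>] curve_diff_inner(1)[OF assms(2), of \<theta>]
    by (auto simp: support_def curve_add_pi inner_diff_left)
qed

text \<open>The perpendicular coordinate increases to its maximum at \<open>\<theta> + \<pi>/2\<close> and then decreases; its two
  end values are opposite, so both are at least minus the maximum.\<close>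

lemma frame_coordinate_2:
  assumes "\<theta> \<le> t" "t \<le> \<theta> + pi"
  shows "\<bar>curve t \<bullet> dir (\<theta> + pi/2)\<bar> \<le> support (\<theta> + pi/2)"
proof -
  have i: "(\<lambda>s. w s * cos (s - \<theta>)) integrable_on {a..b}" for a b
    by (rule integrable_w_mult[where C = 1]) auto
  have pos: "0 \<le> integral {a..b} (\<lambda>s. w s * cos (s - \<theta>))" if "\<theta> \<le> a" "b \<le> \<theta> + pi/2" for a b
    by (rule Henstock_Kurzweil_Integration.integral_nonneg[OF i])
       (use that in \<open>auto intro!: mult_nonneg_nonneg w_nonneg cos_ge_zero\<close>)
  have neg: "integral {a..b} (\<lambda>s. w s * cos (s - \<theta>)) \<le> 0" if "\<theta> + pi/2 \<le> a" "b \<le> \<theta> + pi" for a b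
  proof -
    have "cos (s - \<theta>) \<le> 0" if "a \<le> s" "s \<le> b" for s
      using cos_ge_zero[of "s - \<theta> - pi"] that \<open>\<theta> + pi/2 \<le> a\<close> \<open>b \<le> \<theta> + pi\<close> by (simp add: cos_diff)
    then have "0 \<le> integral {a..b} (\<lambda>s. - (w s * cos (s - \<theta>)))"
      by (intro Henstock_Kurzweil_Integration.integral_nonneg integrable_neg i)
         (auto simp: mult_le_0_iff w_nonneg)
    then show ?thesis by simp
  qed
  have L: "curve t \<bullet> dir (\<theta> + pi/2) \<le> support (\<theta> + pi/2)" if t: "\<theta> \<le> t" "t \<le> \<theta> + pi" for t
  proof (cases "t \<le> \<theta> + pi/2")
    case True
    then show ?thesis using curve_diff_inner(2)[OF True, of \<theta>] pos[of t "\<theta>+pi/2"] t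
      by (simp add: support_def inner_diff_left)
  next
    case False
    then show ?thesis using curve_diff_inner(2)[of "\<theta>+pi/2" t \<theta>] neg[of "\<theta>+pi/2" t] t
      by (simp add: support_def inner_diff_left)
  qed
  have end0: "curve \<theta> \<bullet> dir (\<theta> + pi/2) \<le> support (\<theta> + pi/2)" "- (curve \<theta> \<bullet> dir (\<theta> + pi/2)) \<le> support (\<theta> + pi/2)"
    using L[of \<theta>] L[of "\<theta> + pi"] by (auto simp: curve_add_pi)
  have "- support (\<theta> + pi/2) \<le> curve t \<bullet> dir (\<theta> + pi/2)"
  proof (cases "t \<le> \<theta> + pi/2")
    case True
    then show ?thesis using curve_diff_inner(2)[of \<theta> t \<theta>] pos[of \<theta> t] assms end0
      by (simp add: inner_diff_left)
  next
    case False
    then show ?thesis using curve_diff_inner(2)[of t "\<theta>+pi" \<theta>] neg[of t "\<theta>+pi"] assms end0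
      by (simp add: curve_add_pi inner_diff_left)
  qed
  with L[OF assms] show ?thesis by linarith
qed

definition half_gauss_length :: real where
  "half_gauss_length = integral {\<theta>..\<theta> + pi} (\<lambda>s. w s * exp (- (norm (curve s))\<^sup>2 / 2))"

lemma integrable_half_gauss_length: "(\<lambda>s. w s * exp (- (norm (curve s))\<^sup>2 / 2)) integrable_on {a..b}"
  by (rule integrable_w_mult[where C = 1]) auto

lemma gauss_weight_split:
  "exp (- (norm (curve s))\<^sup>2 / 2) = exp (- (curve s \<bullet> dir \<theta>)\<^sup>2 / 2) * exp (- (curve s \<bullet> dir (\<theta> + pi/2))\<^sup>2 / 2)"
  by (simp add: norm_frame[of _ \<theta>] exp_add[symmetric] add_divide_distrib)

text \<open>The weight is a product of one-dimensional Gaussian weights in the two coordinates. The perpendicular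
  one is bounded below by its value at the greatest height, and what remains is the exact integral of
  the other weight over the monotone motion from \<open>support \<theta>\<close> to \<open>- support \<theta>\<close>.\<close>

lemma sine_part:
  "exp (- (support (\<theta> + pi/2))\<^sup>2 / 2) * (2 * gauss_primitive (support \<theta>))
     \<le> integral {\<theta>..\<theta> + pi} (\<lambda>s. w s * (sin (s - \<theta>) * exp (- (norm (curve s))\<^sup>2 / 2)))"
proof -
  let ?y = "\<lambda>t. curve t \<bullet> dir \<theta>" and ?L = "support (\<theta> + pi/2)"
  let ?v = "\<lambda>s. w s * (- sin (s - \<theta>))"
  have i: "(\<lambda>s. exp (- (?y s)\<^sup>2 / 2) * ?v s) integrable_on {\<theta>..\<theta> + pi}"
    using integrable_w_mult[of "\<lambda>s. exp (- (?y s)\<^sup>2 / 2) * (- sin (s - \<theta>))" 1 \<theta> "\<theta> + pi"]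
    by (simp add: abs_mult mult_le_one mult_ac)
  have "gauss_primitive (?y (\<theta> + pi)) - gauss_primitive (?y \<theta>) = integral {\<theta>..\<theta> + pi} (\<lambda>s. exp (- (?y s)\<^sup>2 / 2) * ?v s)"
  proof (rule chain_rule_primitive[where F' = "\<lambda>z. exp (- z\<^sup>2 / 2)" and K = 1 and B = B, OF _ _ _ gauss_primitive_deriv gauss_density_lipschitz _ i])
    show "?y t - ?y s = integral {s..t} ?v" if "s \<le> t" for s t
      using curve_diff_inner(1)[OF that, of \<theta>] by (simp add: inner_diff_left)
    show "\<bar>?v t\<bar> \<le> B" for t
      using mult_mono[of "w t" B "\<bar>sin (t - \<theta>)\<bar>" 1] w_nonneg[of t] w_le[of t] B_nonneg
      by (simp add: abs_mult)
  qed auto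
  then have "2 * gauss_primitive (support \<theta>) = integral {\<theta>..\<theta> + pi} (\<lambda>s. w s * (sin (s - \<theta>) * exp (- (?y s)\<^sup>2 / 2)))"
    by (simp add: curve_add_pi gauss_primitive_minus support_def mult_ac)
  then have "exp (- ?L\<^sup>2 / 2) * (2 * gauss_primitive (support \<theta>)) = integral {\<theta>..\<theta> + pi} (\<lambda>s. exp (- ?L\<^sup>2 / 2) * (w s * (sin (s - \<theta>) * exp (- (?y s)\<^sup>2 / 2))))"
    by simp
  also have "\<dots> \<le> integral {\<theta>..\<theta> + pi} (\<lambda>s. w s * (sin (s - \<theta>) * exp (- (norm (curve s))\<^sup>2 / 2)))"
  proof (rule integral_le)
    show "(\<lambda>s. w s * (sin (s - \<theta>) * exp (- (norm (curve s))\<^sup>2 / 2))) integrable_on {\<theta>..\<theta> + pi}"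
      by (rule integrable_w_mult[where C = 1]) (auto simp: abs_mult intro!: mult_le_one)
    have "(\<lambda>s. w s * (sin (s - \<theta>) * exp (- (?y s)\<^sup>2 / 2))) integrable_on {\<theta>..\<theta> + pi}"
      by (rule integrable_w_mult[where C = 1]) (auto simp: abs_mult intro!: mult_le_one)
    then show "(\<lambda>s. exp (- ?L\<^sup>2 / 2) * (w s * (sin (s - \<theta>) * exp (- (?y s)\<^sup>2 / 2)))) integrable_on {\<theta>..\<theta> + pi}"
      by (intro integrable_on_mult_right) 
    fix s assume s: "s \<in> {\<theta>..\<theta> + pi}"
    have "(curve s \<bullet> dir (\<theta> + pi/2))\<^sup>2 \<le> ?L\<^sup>2"
      using frame_coordinate_2[of s] s by (intro abs_le_square_iff[THEN iffD1]) auto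
    then have "exp (- ?L\<^sup>2 / 2) \<le> exp (- (curve s \<bullet> dir (\<theta> + pi/2))\<^sup>2 / 2)" by simp
    then have "(w s * (sin (s - \<theta>) * exp (- (?y s)\<^sup>2 / 2))) * exp (- ?L\<^sup>2 / 2) \<le> (w s * (sin (s - \<theta>) * exp (- (?y s)\<^sup>2 / 2))) * exp (- (curve s \<bullet> dir (\<theta> + pi/2))\<^sup>2 / 2)"
      using s by (intro mult_left_mono mult_nonneg_nonneg w_nonneg sin_ge_zero) auto
    then show "exp (- ?L\<^sup>2 / 2) * (w s * (sin (s - \<theta>) * exp (- (?y s)\<^sup>2 / 2))) \<le> w s * (sin (s - \<theta>) * exp (- (norm (curve s))\<^sup>2 / 2))"
      unfolding gauss_weight_split by (simp only: mult_ac)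
  qed
  finally show ?thesis .
qed

text \<open>As before with the coordinates exchanged. The height rises from some \<open>y\<close> to the maximum and falls to
  \<open>- y\<close>; the contributions of \<open>y\<close> cancel since the primitive is odd.\<close>

lemma cosine_part:
  "exp (- (support \<theta>)\<^sup>2 / 2) * (2 * gauss_primitive (support (\<theta> + pi/2)))
     \<le> integral {\<theta>..\<theta> + pi} (\<lambda>s. w s * (\<bar>cos (s - \<theta>)\<bar> * exp (- (norm (curve s))\<^sup>2 / 2)))"
proof -
  let ?y = "\<lambda>t. curve t \<bullet> dir (\<theta> + pi/2)" and ?m = "support \<theta>"
  let ?v = "\<lambda>s. w s * cos (s - \<theta>)"
  let ?f = "\<lambda>s. w s * (\<bar>cos (s - \<theta>)\<bar> * exp (- (?y s)\<^sup>2 / 2))"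
  have i: "(\<lambda>s. exp (- (?y s)\<^sup>2 / 2) * ?v s) integrable_on {a..b}" for a b
    using integrable_w_mult[of "\<lambda>s. exp (- (?y s)\<^sup>2 / 2) * cos (s - \<theta>)" 1 a b]
    by (simp add: abs_mult mult_le_one mult_ac)
  have fi: "?f integrable_on {a..b}" for a b
    by (rule integrable_w_mult[where C = 1]) (auto simp: abs_mult intro!: mult_le_one)
  have chain: "gauss_primitive (?y b) - gauss_primitive (?y a) = integral {a..b} (\<lambda>s. exp (- (?y s)\<^sup>2 / 2) * ?v s)" if "a \<le> b" for a b
  proof (rule chain_rule_primitive[where F' = "\<lambda>z. exp (- z\<^sup>2 / 2)" and K = 1 and B = B, OF _ _ _ gauss_primitive_deriv gauss_density_lipschitz that i])
    show "?y t - ?y s = integral {s..t} ?v" if "s \<le> t" for s t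
      using curve_diff_inner(2)[OF that, of \<theta>] by (simp add: inner_diff_left)
    show "\<bar>?v t\<bar> \<le> B" for t
      using mult_mono[of "w t" B "\<bar>cos (t - \<theta>)\<bar>" 1] w_nonneg[of t] w_le[of t] B_nonneg
      by (simp add: abs_mult)
  qed auto
  have 1: "gauss_primitive (support (\<theta> + pi/2)) - gauss_primitive (?y \<theta>) = integral {\<theta>..\<theta> + pi/2} ?f"
    unfolding support_def chain[of \<theta> "\<theta> + pi/2", simplified]
    by (rule Henstock_Kurzweil_Integration.integral_cong) (auto simp: cos_ge_zero)
  have "cos (s - \<theta>) \<le> 0" if "\<theta> + pi/2 \<le> s" "s \<le> \<theta> + pi" for s
    using cos_ge_zero[of "s - \<theta> - pi"] that by (simp add: cos_diff)
  then have "gauss_primitive (?y (\<theta> + pi)) - gauss_primitive (support (\<theta> + pi/2)) = integral {\<theta> + pi/2..\<theta> + pi} (\<lambda>s. - ?f s)"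
    unfolding support_def chain[of "\<theta> + pi/2" "\<theta> + pi", simplified]
    by (intro Henstock_Kurzweil_Integration.integral_cong) auto
  then have 2: "gauss_primitive (?y \<theta>) + gauss_primitive (support (\<theta> + pi/2)) = integral {\<theta> + pi/2..\<theta> + pi} ?f"
    by (simp add: curve_add_pi gauss_primitive_minus)
  have "integral {\<theta>..\<theta> + pi/2} ?f + integral {\<theta> + pi/2..\<theta> + pi} ?f = integral {\<theta>..\<theta> + pi} ?f"
    by (rule Henstock_Kurzweil_Integration.integral_combine[OF _ _ fi]) auto
  with 1 2 have "exp (- ?m\<^sup>2 / 2) * (2 * gauss_primitive (support (\<theta> + pi/2))) = integral {\<theta>..\<theta> + pi} (\<lambda>s. exp (- ?m\<^sup>2 / 2) * ?f s)"
    by simp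
  also have "\<dots> \<le> integral {\<theta>..\<theta> + pi} (\<lambda>s. w s * (\<bar>cos (s - \<theta>)\<bar> * exp (- (norm (curve s))\<^sup>2 / 2)))"
  proof (rule integral_le)
    show "(\<lambda>s. w s * (\<bar>cos (s - \<theta>)\<bar> * exp (- (norm (curve s))\<^sup>2 / 2))) integrable_on {\<theta>..\<theta> + pi}"
      by (rule integrable_w_mult[where C = 1]) (auto simp: abs_mult intro!: mult_le_one)
    show "(\<lambda>s. exp (- ?m\<^sup>2 / 2) * ?f s) integrable_on {\<theta>..\<theta> + pi}"
      by (rule integrable_on_mult_right[OF fi])
    fix s assume s: "s \<in> {\<theta>..\<theta> + pi}"
    have "(curve s \<bullet> dir \<theta>)\<^sup>2 \<le> ?m\<^sup>2"
      using frame_coordinate_1[of s] s by (intro abs_le_square_iff[THEN iffD1]) auto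
    then have "exp (- ?m\<^sup>2 / 2) \<le> exp (- (curve s \<bullet> dir \<theta>)\<^sup>2 / 2)" by simp
    then have "?f s * exp (- ?m\<^sup>2 / 2) \<le> ?f s * exp (- (curve s \<bullet> dir \<theta>)\<^sup>2 / 2)"
      by (intro mult_left_mono mult_nonneg_nonneg w_nonneg) auto
    then show "exp (- ?m\<^sup>2 / 2) * ?f s \<le> w s * (\<bar>cos (s - \<theta>)\<bar> * exp (- (norm (curve s))\<^sup>2 / 2))"
      unfolding gauss_weight_split by (simp only: mult_ac)
  qed
  finally show ?thesis .
qed

text \<open>The length element dominates each coordinate differential, and also their sum divided by \<open>sqrt 2\<close>.\<close>

lemma half_gauss_length_lower_bounds:
  defines "P \<equiv> exp (- (support (\<theta> + pi/2))\<^sup>2 / 2) * (2 * gauss_primitive (support \<theta>))"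
    and "Q \<equiv> exp (- (support \<theta>)\<^sup>2 / 2) * (2 * gauss_primitive (support (\<theta> + pi/2)))"
  shows "P \<le> half_gauss_length" "Q \<le> half_gauss_length" "P + Q \<le> sqrt 2 * half_gauss_length"
proof -
  let ?e = "\<lambda>s. exp (- (norm (curve s))\<^sup>2 / 2)"
  let ?S = "\<lambda>s. w s * (sin (s - \<theta>) * ?e s)" and ?C = "\<lambda>s. w s * (\<bar>cos (s - \<theta>)\<bar> * ?e s)"
  have S: "?S integrable_on {\<theta>..\<theta>+pi}" and C: "?C integrable_on {\<theta>..\<theta>+pi}"
    by (rule integrable_w_mult[where C = 1]; auto simp: abs_mult intro!: mult_le_one)+
  have "integral {\<theta>..\<theta>+pi} ?S \<le> half_gauss_length" unfolding half_gauss_length_def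
  proof (rule integral_le[OF S integrable_half_gauss_length])
    show "?S s \<le> w s * ?e s" for s
      using mult_right_mono[OF sin_le_one[of "s - \<theta>"], of "?e s"] by (intro mult_left_mono w_nonneg) auto
  qed
  with sine_part show "P \<le> half_gauss_length" unfolding P_def by linarith
  have "integral {\<theta>..\<theta>+pi} ?C \<le> half_gauss_length" unfolding half_gauss_length_def
  proof (rule integral_le[OF C integrable_half_gauss_length])
    show "?C s \<le> w s * ?e s" for s
      using mult_right_mono[OF abs_cos_le_one[of "s - \<theta>"], of "?e s"] by (intro mult_left_mono w_nonneg) auto
  qed
  with cosine_part show "Q \<le> half_gauss_length" unfolding Q_def by linarith
  have sc: "sin r + \<bar>cos r\<bar> \<le> sqrt 2" for r :: real
  proof (rule real_le_rsqrt)
    have "(sin r + \<bar>cos r\<bar>)\<^sup>2 + (sin r - \<bar>cos r\<bar>)\<^sup>2 = 2 * ((sin r)\<^sup>2 + (cos r)\<^sup>2)"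
      by (simp add: power2_eq_square algebra_simps)
    then show "(sin r + \<bar>cos r\<bar>)\<^sup>2 \<le> 2"
      using zero_le_power2[of "sin r - \<bar>cos r\<bar>"] unfolding sin_cos_squared_add by linarith
  qed
  have "integral {\<theta>..\<theta>+pi} ?S + integral {\<theta>..\<theta>+pi} ?C = integral {\<theta>..\<theta>+pi} (\<lambda>s. ?S s + ?C s)"
    by (rule Henstock_Kurzweil_Integration.integral_add[OF S C, symmetric])
  also have "\<dots> \<le> integral {\<theta>..\<theta>+pi} (\<lambda>s. sqrt 2 * (w s * ?e s))"
  proof (rule integral_le)
    show "(\<lambda>s. sqrt 2 * (w s * ?e s)) integrable_on {\<theta>..\<theta> + pi}"
      using integrable_half_gauss_length by (intro integrable_on_mult_right) 
    show "?S s + ?C s \<le> sqrt 2 * (w s * ?e s)" for s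
      using mult_right_mono[OF sc[of "s - \<theta>"], of "w s * ?e s"] w_nonneg[of s] by (simp add: algebra_simps)
  qed (intro integrable_add S C)
  also have "\<dots> = sqrt 2 * half_gauss_length" by (simp add: half_gauss_length_def)
  finally show "P + Q \<le> sqrt 2 * half_gauss_length" using sine_part cosine_part by (simp add: P_def Q_def)
qed

end

end

section \<open>An a priori bound\<close>

lemma integral_sine_half_turn:
  "(\<lambda>s. sin (s - \<theta>)) integrable_on {\<theta>..\<theta> + pi}" "integral {\<theta>..\<theta> + pi} (\<lambda>s. sin (s - \<theta>)) = 2"
proof -
  have "((\<lambda>s. sin (s - \<theta>)) has_integral (- cos (\<theta> + pi - \<theta>) - - cos (\<theta> - \<theta>))) {\<theta>..\<theta> + pi}"
    by (rule fundamental_theorem_of_calculus)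
       (auto intro!: derivative_eq_intros simp flip: has_real_derivative_iff_has_vector_derivative)
  then show "(\<lambda>s. sin (s - \<theta>)) integrable_on {\<theta>..\<theta> + pi}" "integral {\<theta>..\<theta> + pi} (\<lambda>s. sin (s - \<theta>)) = 2"
    by (auto simp: has_integral_iff)
qed

text \<open>The representative of \<open>t\<close> modulo \<open>\<pi>\<close> in the interval from 0 to \<open>\<pi>\<close>.\<close>

definition reduce_mod_pi :: "real \<Rightarrow> real" where
  "reduce_mod_pi t = t - pi * of_int \<lfloor>t / pi\<rfloor>"

lemma reduce_mod_pi_bounds: "0 \<le> reduce_mod_pi t" "reduce_mod_pi t < pi"
proof -
  have "pi * of_int \<lfloor>t / pi\<rfloor> \<le> pi * (t / pi)" "pi * (t / pi) < pi * (of_int \<lfloor>t / pi\<rfloor> + 1)"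
    by (intro mult_left_mono mult_strict_left_mono; (linarith | simp))+
  then show "0 \<le> reduce_mod_pi t" "reduce_mod_pi t < pi" by (auto simp: reduce_mod_pi_def distrib_left)
qed

lemma reduce_mod_pi_add_pi: "reduce_mod_pi (t + pi) = reduce_mod_pi t"
proof -
  have "(t + pi) / pi = t / pi + 1" by (simp add: field_simps)
  then have "\<lfloor>(t + pi) / pi\<rfloor> = \<lfloor>t / pi\<rfloor> + 1" by simp
  then show ?thesis by (simp add: reduce_mod_pi_def algebra_simps)
qed

lemma reduce_mod_pi_id: "0 \<le> t \<Longrightarrow> t < pi \<Longrightarrow> reduce_mod_pi t = t"
  by (simp add: reduce_mod_pi_def floor_eq_iff field_simps)

lemma periodic_reduce_mod_pi:
  fixes f :: "real \<Rightarrow> 'a"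
  assumes "\<And>t. f (t + pi) = f t"
  shows "f (reduce_mod_pi t) = f t"
proof -
  have n: "f (t + pi * real n) = f t" for t n
    by (induction n) (use assms in \<open>auto simp: algebra_simps\<close>, metis add.assoc add.commute assms)
  have "f (t - pi * of_int k) = f t" for k :: int
  proof (cases k)
    case (nonneg n)
    then show ?thesis using n[of "t - pi * real n" n] by simp
  next
    case (neg n)
    then have "of_int k = - real (Suc n)" by simp
    then show ?thesis using n[of t "Suc n"] by (simp only: mult_minus_right diff_minus_eq_add)
  qed
  then show ?thesis by (simp add: reduce_mod_pi_def)
qed

context radius_function
begin

lemma support_le_norm: "support t \<le> norm (curve t)"
  using Cauchy_Schwarz_ineq2[of "curve t" "dir t"] by (simp add: support_def)

lemma support_nonneg: "0 \<le> support t"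
proof -
  have "0 \<le> integral {t..t + pi} (\<lambda>s. w s * sin (s - t))"
    by (rule Henstock_Kurzweil_Integration.integral_nonneg)
       (auto intro!: integrable_w_mult[where C = 1] mult_nonneg_nonneg w_nonneg sin_ge_zero)
  then show ?thesis using two_support[of t] by linarith
qed

lemma support_ge_of_w_ge:
  assumes "\<And>s. \<theta> \<le> s \<Longrightarrow> s \<le> \<theta> + pi \<Longrightarrow> b \<le> w s"
  shows "b \<le> support \<theta>"
proof -
  have "2 * b = integral {\<theta>..\<theta>+pi} (\<lambda>s. b * sin (s - \<theta>))"
    by (simp add: integral_sine_half_turn)
  also have "\<dots> \<le> integral {\<theta>..\<theta>+pi} (\<lambda>s. w s * sin (s - \<theta>))"
  proof (rule integral_le)
    show "(\<lambda>s. b * sin (s - \<theta>)) integrable_on {\<theta>..\<theta> + pi}"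
      by (intro integrable_on_mult_right integral_sine_half_turn)
    show "(\<lambda>s. w s * sin (s - \<theta>)) integrable_on {\<theta>..\<theta> + pi}"
      by (rule integrable_w_mult[where C = 1]) auto
  qed (auto intro!: mult_right_mono assms sin_ge_zero)
  finally show ?thesis using two_support[of \<theta>] by linarith
qed

lemma norm_curve_le_frame:
  assumes "\<theta> \<le> t" "t \<le> \<theta> + pi"
  shows "norm (curve t) \<le> support \<theta> + support (\<theta> + pi/2)"
proof -
  show ?thesis
    using norm_le_frame[of "curve t" \<theta>] frame_coordinate_1[OF assms] frame_coordinate_2[OF assms] by linarith
qed

text \<open>The support value controls the radius of curvature away from the direction \<open>dir \<theta>\<close>: twice
  \<open>support \<theta>\<close> is the integral of \<open>w\<close> against a sine that is at least \<open>sqrt 2 / 2\<close> on the middle half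
  of the half turn, and \<open>2 * sqrt 2 \<le> 3\<close>.\<close>

lemma middle_mass: "integral {\<theta> + pi/4..\<theta> + 3*pi/4} w \<le> 3 * support \<theta>"
proof -
  let ?J = "{\<theta> + pi/4..\<theta> + 3*pi/4}"
  have int_sin: "(\<lambda>s. w s * sin (s - \<theta>)) integrable_on {a..b}" for a b
    by (rule integrable_w_mult[where C = 1]) auto
  have sn: "sqrt 2 / 2 \<le> sin r" if "pi/4 \<le> r" "r \<le> 3*pi/4" for r
  proof -
    have "sin (pi/4) \<le> sin r"
    proof (cases "r \<le> pi/2")
      case True then show ?thesis using that by (intro sin_monotone_2pi_le) auto
    next
      case False
      have "sin (pi/4) \<le> sin (pi - r)" using that False by (intro sin_monotone_2pi_le) auto
      then show ?thesis by simp
    qed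
    then show ?thesis by (simp add: sin_45)
  qed
  have D: "sqrt 2 / 2 * integral ?J w \<le> 2 * support \<theta>"
  proof -
    have "sqrt 2 / 2 * integral ?J w = integral ?J (\<lambda>s. sqrt 2 / 2 * w s)" by simp
    also have "\<dots> \<le> integral ?J (\<lambda>s. w s * sin (s - \<theta>))"
    proof (rule integral_le)
      show "(\<lambda>s. sqrt 2 / 2 * w s) integrable_on ?J" by (intro integrable_on_mult_right integrable_w)
      show "sqrt 2 / 2 * w s \<le> w s * sin (s - \<theta>)" if "s \<in> ?J" for s
        using mult_left_mono[OF sn[of "s - \<theta>"] w_nonneg[of s]] that by (simp add: mult.commute)
    qed (rule int_sin)
    also have "\<dots> \<le> integral {\<theta>..\<theta> + pi} (\<lambda>s. w s * sin (s - \<theta>))"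
      by (rule integral_subset_le) (auto intro!: int_sin mult_nonneg_nonneg w_nonneg sin_ge_zero)
    finally show ?thesis using two_support[of \<theta>] by linarith
  qed
  have "sqrt 2 * (sqrt 2 / 2 * integral ?J w) \<le> sqrt 2 * (2 * support \<theta>)" by (rule mult_left_mono[OF D]) simp
  then have "integral ?J w \<le> (2 * sqrt 2) * support \<theta>" by (simp add: mult.assoc[symmetric])
  also have "\<dots> \<le> 3 * support \<theta>"
  proof (rule mult_right_mono[OF _ support_nonneg])
    have "sqrt 2 \<le> 3/2" by (rule real_le_lsqrt) (auto simp: power2_eq_square)
    then show "2 * sqrt 2 \<le> 3" by simp
  qed
  finally show ?thesis .
qed

text \<open>An elongated body is high above its whole middle part, because the arc there is short by
  \<open>middle_mass\<close>.\<close>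

lemma middle_height:
  assumes t: "\<theta> + pi/4 \<le> t" "t \<le> \<theta> + 3*pi/4"
  shows "support (\<theta> + pi/2) - 3 * support \<theta> \<le> norm (curve t)"
proof -
  let ?J = "{\<theta> + pi/4..\<theta> + 3*pi/4}"
  have step: "\<bar>(curve b - curve a) \<bullet> dir (\<theta> + pi/2)\<bar> \<le> integral ?J w" if "a \<le> b" "a \<in> ?J" "b \<in> ?J" for a b
  proof -
    have "\<bar>integral {a..b} (\<lambda>s. w s * cos (s - \<theta>))\<bar> \<le> integral {a..b} w"
    proof (rule integral_norm_bound_integral[where 'a = real, unfolded real_norm_def])
      show "(\<lambda>s. w s * cos (s - \<theta>)) integrable_on {a..b}" by (rule integrable_w_mult[where C = 1]) auto
      show "\<bar>w s * cos (s - \<theta>)\<bar> \<le> w s" for s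
        using mult_left_mono[OF abs_cos_le_one[of "s - \<theta>"] w_nonneg[of s]] by (simp add: abs_mult w_nonneg)
    qed (rule integrable_w)
    also have "\<dots> \<le> integral ?J w"
      by (rule integral_subset_le) (use that integrable_w w_nonneg in auto)
    finally show ?thesis using curve_diff_inner(2)[OF \<open>a \<le> b\<close>] by simp
  qed
  have "support (\<theta> + pi/2) - curve t \<bullet> dir (\<theta> + pi/2) \<le> integral ?J w"
    using step[of t "\<theta> + pi/2"] step[of "\<theta> + pi/2" t] t
    by (cases "t \<le> \<theta> + pi/2") (auto simp: support_def inner_diff_left abs_le_iff)
  moreover have "curve t \<bullet> dir (\<theta> + pi/2) \<le> norm (curve t)"
    using Cauchy_Schwarz_ineq2[of "curve t" "dir (\<theta> + pi/2)"] by simp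
  ultimately show ?thesis using middle_mass[of \<theta>] by linarith
qed

text \<open>The exponential growth of the weight rules out large bodies, and a body that is thin but long as well.
  Let \<open>m\<close> be the least support value, attained at \<open>\<theta>\<close>. All points have norm at least \<open>m\<close>, so
  \<open>m \<ge> c exp (m\<^sup>2/2)\<close>, which gives \<open>m \<le> 2/c\<close>. If the perpendicular support value were large, then
  the middle part of the arc would be far from the origin, hence \<open>w\<close> large there, against
  \<open>middle_mass\<close>. The weight is truncated at radius \<open>12/c\<close>, beyond the bound obtained, so that the
  truncation is invisible on solutions.\<close>

lemma a_priori_bound:
  assumes c: "0 < c" and wc: "\<And>t. c * exp ((min (norm (curve t)) (12 / c))\<^sup>2 / 2) \<le> w t"
    and h0: "support 0 \<le> 12 / c"
  shows "norm (curve t) \<le> 11 / c"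
proof -
  obtain \<theta> where th: "\<theta> \<in> {0..pi}" and min: "\<And>s. s \<in> {0..pi} \<Longrightarrow> support \<theta> \<le> support s"
    using continuous_attains_inf[OF compact_Icc _ continuous_support, of 0 pi] by force
  define m where "m = support \<theta>"
  define L where "L = support (\<theta> + pi/2)"
  have m0: "0 \<le> m" unfolding m_def by (rule support_nonneg)
  have mR: "m \<le> 12 / c" using min[of 0] h0 by (simp add: m_def)
  have m_le: "m \<le> norm (curve s)" if "\<theta> \<le> s" "s \<le> \<theta> + pi" for s
  proof -
    have "m \<le> support s"
    proof (cases "s \<le> pi")
      case True then show ?thesis using that th min by (simp add: m_def)
    next
      case False
      then show ?thesis using that th min[of "s - pi"] support_add_pi[of "s - pi"] by (simp add: m_def)
    qed
    then show ?thesis using support_le_norm[of s] by linarith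
  qed
  have "c * exp (m\<^sup>2 / 2) \<le> w s" if "\<theta> \<le> s" "s \<le> \<theta> + pi" for s
  proof -
    have "exp (m\<^sup>2 / 2) \<le> exp ((min (norm (curve s)) (12 / c))\<^sup>2 / 2)"
      using m_le[OF that] mR m0 by (auto intro!: power_mono)
    then show ?thesis using wc[of s] c by (meson mult_left_mono less_imp_le order_trans)
  qed
  from support_ge_of_w_ge[OF this, where \<theta> = \<theta>] have "c * exp (m\<^sup>2 / 2) \<le> m" by (simp add: m_def)
  moreover have "c * (1 + m\<^sup>2 / 2) \<le> c * exp (m\<^sup>2 / 2)"
    using c exp_ge_add_one_self[of "m\<^sup>2 / 2"] by (intro mult_left_mono) auto
  ultimately have m1: "c * (1 + m\<^sup>2 / 2) \<le> m" by linarith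
  have "0 < c * (1 + m\<^sup>2 / 2)" using c by (intro mult_pos_pos add_pos_nonneg) auto
  then have mpos: "0 < m" using m1 by linarith
  have "(c * m) * m \<le> 2 * m" using m1 c by (simp add: algebra_simps power2_eq_square)
  then have m2: "m \<le> 2 / c" using mpos c by (simp add: field_simps)
  (* The lower bound for the norm on the middle part of the arc, from middle_height. *)
  define b where "b = L - 3 * m"
  have b3: "b \<le> 3 / c"
  proof (rule ccontr)
    assume nb: "\<not> b \<le> 3 / c"
    let ?J = "{\<theta> + pi/4..\<theta> + 3*pi/4}"
    let ?e = "min b (12 / c)"
    have e3: "3 / c < ?e" using nb c by (auto simp: divide_strict_right_mono)
    moreover have "0 < 3 / c" using c by simp
    ultimately have e0: "0 \<le> ?e" by linarith
    have J: "c * exp (?e\<^sup>2 / 2) \<le> w s" if "s \<in> ?J" for s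
    proof -
      have "b \<le> norm (curve s)" using middle_height[of \<theta> s] that by (auto simp: b_def L_def m_def)
      then have "exp (?e\<^sup>2 / 2) \<le> exp ((min (norm (curve s)) (12 / c))\<^sup>2 / 2)"
        using e0 by (auto intro!: power_mono)
      then show ?thesis using wc[of s] c by (meson mult_left_mono less_imp_le order_trans)
    qed
    have "(pi/2) * (c * exp (?e\<^sup>2 / 2)) = integral ?J (\<lambda>s. c * exp (?e\<^sup>2 / 2))" by simp
    also have "\<dots> \<le> integral ?J w"
      by (rule integral_le) (use J integrable_w in auto)
    also have "\<dots> \<le> 3 * m" unfolding m_def by (rule middle_mass)
    finally have *: "(pi/2) * (c * exp (?e\<^sup>2 / 2)) \<le> 3 * m" .
    have "(3 / c)\<^sup>2 \<le> ?e\<^sup>2" using e3 c by (intro power_mono) auto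
    then have "c * (3 / c)\<^sup>2 \<le> c * ?e\<^sup>2" using c by (intro mult_left_mono) auto
    then have ce: "9 / c \<le> c * ?e\<^sup>2" using c by (simp add: power_divide power2_eq_square)
    have le: "(3/2) * (c * (1 + ?e\<^sup>2 / 2)) \<le> (pi/2) * (c * exp (?e\<^sup>2 / 2))"
      using c exp_ge_add_one_self[of "?e\<^sup>2 / 2"] pi_gt3 by (intro mult_mono mult_left_mono) auto
    have "3 * m \<le> 6 / c" using m2 by simp
    from order_trans[OF order_trans[OF le *] this]
    have "(3/2) * (c * (1 + ?e\<^sup>2 / 2)) \<le> 6 / c" .
    then have "(3/2) * c + (3/4) * (c * ?e\<^sup>2) \<le> 6 / c" by (simp add: algebra_simps)
    with ce have "(3/2) * c + (3/4) * (9 / c) \<le> 6 / c" by linarith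
    moreover have "9 / c = 9 * (1 / c)" "6 / c = 6 * (1 / c)" "0 < 1 / c" using c by simp_all
    ultimately show False using c by argo
  qed
  have "L \<le> 9 / c" using b3 m2 c by (simp add: b_def field_simps)
  have n: "norm (curve t) \<le> 11 / c" if "t \<in> {0..pi}" for t
  proof -
    have "norm (curve t) \<le> m + L"
    proof (cases "\<theta> \<le> t")
      case True
      then show ?thesis using norm_curve_le_frame[of \<theta> t] that th by (simp add: m_def L_def)
    next
      case False
      then show ?thesis using norm_curve_le_frame[of \<theta> "t + pi"] that th by (simp add: m_def L_def curve_add_pi)
    qed
    also have "\<dots> \<le> 2 / c + 9 / c" using \<open>L \<le> 9 / c\<close> m2 by linarith
    also have "\<dots> = 11 / c" by (simp flip: add_divide_distrib)
    finally show ?thesis .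
  qed
  have "norm (curve (reduce_mod_pi t)) = norm (curve t)"
    by (rule periodic_reduce_mod_pi[where f = "\<lambda>t. norm (curve t)"]) (simp add: curve_add_pi)
  with n[of "reduce_mod_pi t"] reduce_mod_pi_bounds[of t] show ?thesis by simp
qed

end

section \<open>Shooting with Brouwer fixed points\<close>

text \<open>The inverse Gaussian weight, made bounded and Lipschitz so that the flow exists for all times.\<close>

definition trunc_weight :: "real \<Rightarrow> real^2 \<Rightarrow> real" where
  "trunc_weight R x = exp ((min (norm x) R)\<^sup>2 / 2)"

lemma trunc_weight_ge_1: "1 \<le> trunc_weight R x"
  by (simp add: trunc_weight_def)

lemma trunc_weight_le: "0 \<le> R \<Longrightarrow> trunc_weight R x \<le> exp (R\<^sup>2 / 2)"
  by (auto simp: trunc_weight_def intro!: power_mono)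

lemma trunc_weight_le_exp: "0 \<le> R \<Longrightarrow> trunc_weight R x \<le> exp ((norm x)\<^sup>2 / 2)"
  by (auto simp: trunc_weight_def intro!: power_mono)

lemma trunc_weight_eq: "norm x \<le> R \<Longrightarrow> trunc_weight R x = exp ((norm x)\<^sup>2 / 2)"
  by (simp add: trunc_weight_def)

lemma trunc_weight_minus [simp]: "trunc_weight R (- x) = trunc_weight R x"
  by (simp add: trunc_weight_def)

lemma trunc_weight_lipschitz:
  assumes "0 \<le> R"
  shows "\<bar>trunc_weight R x - trunc_weight R y\<bar> \<le> (R * exp (R\<^sup>2 / 2)) * norm (x - y)"
proof -
  let ?a = "min (norm x) R" and ?b = "min (norm y) R"
  have "norm (exp (?a\<^sup>2 / 2) - exp (?b\<^sup>2 / 2)) \<le> (R * exp (R\<^sup>2 / 2)) * norm (?a - ?b)"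
  proof (rule field_differentiable_bound[of "{0..R}"])
    fix z assume z: "z \<in> {0..R}"
    show "((\<lambda>z. exp (z\<^sup>2 / 2)) has_field_derivative z * exp (z\<^sup>2 / 2)) (at z within {0..R})"
      by (auto intro!: derivative_eq_intros)
    show "norm (z * exp (z\<^sup>2 / 2)) \<le> R * exp (R\<^sup>2 / 2)"
      using z by (auto simp: abs_mult intro!: mult_mono power_mono)
  qed (use assms in auto)
  moreover have "\<bar>?a - ?b\<bar> \<le> norm (x - y)"
    using norm_triangle_ineq3[of x y] by linarith
  ultimately show ?thesis
    using assms unfolding trunc_weight_def
    by (smt (verit, best) mult_left_mono mult_nonneg_nonneg exp_ge_zero real_norm_def)
qed

lemma trunc_weight_borel [measurable]: "trunc_weight R \<in> borel_measurable borel"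
  unfolding trunc_weight_def by measurable

definition clamp_to :: "real \<Rightarrow> real \<Rightarrow> real \<Rightarrow> real" where
  "clamp_to a b x = max a (min b x)"

lemma clamp_to_in: "a \<le> b \<Longrightarrow> clamp_to a b x \<in> {a..b}"
  by (auto simp: clamp_to_def)

text \<open>A solution on a half turn that ends at the antipode of its starting point extends to a symmetric
  closed curve. At the seam \<open>t = \<pi>\<close> the two definitions of \<open>w\<close> agree because the weight is even.\<close>

lemma periodic_extension:
  fixes X :: "real \<Rightarrow> real^2"
  assumes g [measurable]: "g \<in> borel_measurable borel"
    and g0: "\<And>t. 0 \<le> g t" and gC: "\<And>t. g t \<le> C" and gp: "\<And>t. g (t + pi) = g t"
    and R: "0 \<le> R" and l: "0 \<le> l"
    and X: "continuous_on UNIV X"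
    and eq: "\<And>t. 0 \<le> t \<Longrightarrow> t \<le> pi \<Longrightarrow> X t = p + integral {0..t} (\<lambda>s. (l * trunc_weight R (X s)) *\<^sub>R (g s *\<^sub>R dir (s + pi/2)))"
    and anti: "X pi = - p"
  obtains w B where "radius_function w B" "\<And>t. w t = l * g t * trunc_weight R (radius_function.curve w t)"
    "radius_function.curve w 0 = p"
proof -
  define w where "w t = l * g t * trunc_weight R (X (reduce_mod_pi t))" for t
  have X0: "X 0 = p" using eq[of 0] by simp
  have [measurable]: "X \<in> borel_measurable borel" by (rule borel_measurable_continuous_onI[OF X])
  have [measurable]: "reduce_mod_pi \<in> borel_measurable borel" unfolding reduce_mod_pi_def by measurable
  interpret radius_function w "l * C * exp (R\<^sup>2 / 2)"
  proof
    show "w \<in> borel_measurable borel" unfolding w_def by measurable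
    show "0 \<le> w t" for t using g0 l order_trans[OF zero_le_one trunc_weight_ge_1] by (simp add: w_def)
    show "w t \<le> l * C * exp (R\<^sup>2 / 2)" for t
      unfolding w_def using l g0 gC order_trans[OF g0 gC] order_trans[OF zero_le_one trunc_weight_ge_1]
      by (intro mult_mono mult_left_mono trunc_weight_le R) auto
    show "w (t + pi) = w t" for t by (simp add: w_def gp reduce_mod_pi_add_pi)
  qed
  have wX: "w s = l * g s * trunc_weight R (X s)" if "0 \<le> s" "s \<le> pi" for s
  proof (cases "s = pi")
    case True
    then show ?thesis using reduce_mod_pi_add_pi[of 0] by (simp add: w_def reduce_mod_pi_id X0 anti)
  qed (use that in \<open>simp add: w_def reduce_mod_pi_id\<close>)
  have int: "integral {0..t} (\<lambda>s. w s *\<^sub>R dir (s + pi/2)) = X t - p" if "0 \<le> t" "t \<le> pi" for t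
  proof -
    have "integral {0..t} (\<lambda>s. w s *\<^sub>R dir (s + pi/2)) = integral {0..t} (\<lambda>s. (l * trunc_weight R (X s)) *\<^sub>R (g s *\<^sub>R dir (s + pi/2)))"
      using that by (intro Henstock_Kurzweil_Integration.integral_cong) (simp add: wX mult_ac)
    then show ?thesis using eq[OF that] by simp
  qed
  have crv0: "curve 0 = p"
    using int[of pi] anti by (simp add: curve_def scaleR_2[symmetric] flip: scaleR_minus_right)
  have crvX: "curve t = X t" if "0 \<le> t" "t \<le> pi" for t
    using curve_diff[OF that(1)] int[OF that] crv0 by simp
  have "w t = l * g t * trunc_weight R (curve t)" for t
  proof -
    have "trunc_weight R (curve (reduce_mod_pi t)) = trunc_weight R (curve t)"
      by (rule periodic_reduce_mod_pi[where f = "\<lambda>t. trunc_weight R (curve t)"]) (simp add: curve_add_pi)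
    then show ?thesis using crvX[of "reduce_mod_pi t"] reduce_mod_pi_bounds[of t] by (simp add: w_def)
  qed
  with crv0 show ?thesis using that radius_function_axioms by blast
qed

text \<open>The unknowns are the starting point \<open>p\<close>, the multiplier \<open>l\<close> and the size \<open>s\<close>. A fixed point of
  the first component is a starting point mapped to its antipode. The second component raises \<open>l\<close> as
  long as the actual size \<open>p \<bullet> dir 0\<close> is below \<open>s\<close>: the value \<open>l = 0\<close> is impossible since then the curve
  is a point, and \<open>l = \<Lambda>\<close> is impossible since \<open>l c\<close> never exceeds the size. So the actual size
  is \<open>s\<close> at every fixed point. The sign of \<open>\<sigma>\<close> is left open: the step for \<open>s\<close> must push inwards at
  both ends, and this needs opposite signs for small and for large bodies.\<close>

lemma shooting:
  assumes g [measurable]: "g \<in> borel_measurable borel"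
    and c: "0 < c" and gc: "\<And>t. c \<le> g t" and gC: "\<And>t. g t \<le> C" and gp: "\<And>t. g (t + pi) = g t"
    and s12: "0 < s1" "s1 \<le> s2" "s2 \<le> 12 / c"
  obtains w B l where "radius_function w B" "0 < l"
    "\<And>t. w t = l * g t * trunc_weight (12 / c) (radius_function.curve w t)"
    "radius_function.support w 0 = clamp_to s1 s2 (radius_function.support w 0 + \<sigma> * (l - 1))"
proof -
  define R where "R = 12 / c"
  (* The size is at most 12/c and at least l * c, so l stays strictly below this value. *)
  define \<Lambda> where "\<Lambda> = 12 / c\<^sup>2 + 1"
  have R0: "0 \<le> R" using c by (simp add: R_def)
  have \<Lambda>0: "0 < \<Lambda>" using c by (simp add: \<Lambda>_def add_pos_pos)
  have g0: "0 \<le> g t" for t using gc[of t] c by linarith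
  have C0: "0 \<le> C" using g0[of 0] gC[of 0] by linarith
  define M where "M = exp (R\<^sup>2 / 2)"
  let ?A = "\<lambda>s. g s *\<^sub>R dir (s + pi/2)"
  have Am: "?A \<in> borel_measurable borel" by measurable
  have AG: "norm (?A t) \<le> C" for t using g0[of t] gC[of t] by simp
  have EM: "\<bar>trunc_weight R x\<bar> \<le> M" for x
    using trunc_weight_le[OF R0, of x] trunc_weight_ge_1[of R x] by (simp add: M_def)
  obtain X K where contX: "\<And>p l. continuous_on UNIV (X p l)"
    and Xeq: "\<And>p l t. \<bar>l\<bar> \<le> \<Lambda> \<Longrightarrow> 0 \<le> t \<Longrightarrow> t \<le> pi \<Longrightarrow> X p l t = p + integral {0..t} (\<lambda>s. (l * trunc_weight R (X p l s)) *\<^sub>R ?A s)"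
    and XK: "\<And>p q l m. \<bar>l\<bar> \<le> \<Lambda> \<Longrightarrow> \<bar>m\<bar> \<le> \<Lambda> \<Longrightarrow> norm (X p l pi - X q m pi) \<le> K * (norm (p - q) + \<bar>l - m\<bar>)"
    using caratheodory_flow[OF Am AG EM trunc_weight_lipschitz[OF R0] pi_ge_zero less_imp_le[OF \<Lambda>0]] by blast
  define D where "D = cball (0 :: real^2) (\<Lambda> * M * C * pi) \<times> {0..\<Lambda>} \<times> {s1..s2}"
  define T where "T = (\<lambda>(p :: real^2, l, s). (- (1/2) *\<^sub>R (X p l pi - p), clamp_to 0 \<Lambda> (l + s - p \<bullet> dir 0), clamp_to s1 s2 (s + \<sigma> * (l - 1))))"
  have bound: "norm (X p l pi - p) \<le> \<Lambda> * M * C * pi" if l: "l \<in> {0..\<Lambda>}" for p l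
  proof -
    let ?f = "\<lambda>s. (l * trunc_weight R (X p l s)) *\<^sub>R ?A s"
    have [measurable]: "X p l \<in> borel_measurable borel" by (rule borel_measurable_continuous_onI[OF contX])
    have fB: "norm (?f s) \<le> \<Lambda> * M * C" for s
      unfolding norm_scaleR abs_mult using l EM[of "X p l s"] AG[of s] \<Lambda>0 C0 g0
      by (intro mult_mono mult_nonneg_nonneg) (auto simp: M_def)
    have "?f integrable_on {0..pi}" by (rule bounded_borel_integrable[OF _ fB]) measurable
    then have "norm (integral (cbox 0 pi) ?f) \<le> (\<Lambda> * M * C) * measure lborel (cbox 0 pi)"
      using fB \<Lambda>0 C0 by (intro has_integral_bound[OF _ integrable_integral]) (auto simp: M_def)
    then show ?thesis using Xeq[of l pi p] l by simp
  qed
  have "compact D" "convex D"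
    unfolding D_def by (auto intro!: compact_Times convex_Times)
  moreover have "0 \<le> \<Lambda> * M * C * pi" using \<Lambda>0 C0 by (simp add: M_def)
  then have "D \<noteq> {}" using s12 \<Lambda>0 unfolding D_def by (simp add: not_less)
  moreover have "continuous_on D T"
  proof -
    have "continuous_on D (\<lambda>z. X (fst z) (fst (snd z)) pi)"
      unfolding continuous_on_def
    proof
      fix z assume z: "z \<in> D"
      have "((\<lambda>y. X (fst y) (fst (snd y)) pi - X (fst z) (fst (snd z)) pi) \<longlongrightarrow> 0) (at z within D)"
      proof (rule Lim_null_comparison)
        show "\<forall>\<^sub>F y in at z within D. norm (X (fst y) (fst (snd y)) pi - X (fst z) (fst (snd z)) pi)
            \<le> K * (norm (fst y - fst z) + \<bar>fst (snd y) - fst (snd z)\<bar>)"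
          unfolding eventually_at_filter using z by (intro always_eventually) (auto simp: D_def intro!: XK)
        have "((\<lambda>y. K * (norm (fst y - fst z) + \<bar>fst (snd y) - fst (snd z)\<bar>)) \<longlongrightarrow>
           K * (norm (fst z - fst z) + \<bar>fst (snd z) - fst (snd z)\<bar>)) (at z within D)"
          by (intro tendsto_intros)
        then show "((\<lambda>y. K * (norm (fst y - fst z) + \<bar>fst (snd y) - fst (snd z)\<bar>)) \<longlongrightarrow> 0) (at z within D)" by simp
      qed
      then show "((\<lambda>y. X (fst y) (fst (snd y)) pi) \<longlongrightarrow> X (fst z) (fst (snd z)) pi) (at z within D)"
        by (simp add: LIM_zero_iff)
    qed
    then show ?thesis
      unfolding T_def case_prod_unfold clamp_to_def by (intro continuous_intros)
  qed
  moreover have "T \<in> D \<rightarrow> D"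
  proof
    fix z assume "z \<in> D"
    then obtain p l s where z: "z = (p, l, s)" "l \<in> {0..\<Lambda>}" by (auto simp: D_def)
    have "norm (- (1/2) *\<^sub>R (X p l pi - p)) = norm (X p l pi - p) / 2" by simp
    then have "norm (- (1/2) *\<^sub>R (X p l pi - p)) \<le> \<Lambda> * M * C * pi"
      using bound[OF z(2), of p] norm_ge_zero[of "X p l pi - p"] by linarith
    then show "T z \<in> D"
      using clamp_to_in[of 0 \<Lambda>] clamp_to_in[OF s12(2)] \<Lambda>0 by (simp add: T_def D_def z(1))
  qed
  ultimately obtain z where "z \<in> D" "T z = z" by (rule brouwer)
  then obtain p l s where l: "l \<in> {0..\<Lambda>}" and s: "s \<in> {s1..s2}"
    and p_eq: "- (1/2) *\<^sub>R (X p l pi - p) = p" and l_eq: "clamp_to 0 \<Lambda> (l + s - p \<bullet> dir 0) = l"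
    and s_eq: "clamp_to s1 s2 (s + \<sigma> * (l - 1)) = s"
    by (auto simp: D_def T_def)
  have anti: "X p l pi = - p"
  proof -
    have "X p l pi - p = (-2) *\<^sub>R (- (1/2) *\<^sub>R (X p l pi - p))" by simp
    then show ?thesis unfolding p_eq by (simp add: scaleR_2 algebra_simps)
  qed
  obtain w B where w: "radius_function w B" "\<And>t. w t = l * g t * trunc_weight R (radius_function.curve w t)"
    "radius_function.curve w 0 = p"
    by (rule periodic_extension[OF g g0 gC gp R0 _ contX[of p l] Xeq anti]) (use l in auto)
  interpret radius_function w B by (rule w)
  have h0: "support 0 = p \<bullet> dir 0" by (simp add: support_def w)
  have "0 < l"
  proof (rule ccontr)
    assume "\<not> 0 < l"
    with l have "l = 0" by simp
    then have "w t = 0" for t using w(2) by simp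
    then have "support 0 = 0" using two_support[of 0] by simp
    then show False using l_eq \<open>l = 0\<close> s s12 \<Lambda>0 unfolding h0 clamp_to_def by auto
  qed
  have "l * c \<le> support 0"
  proof (rule support_ge_of_w_ge)
    fix t
    have "(l * c) * 1 \<le> (l * g t) * trunc_weight R (curve t)"
      using \<open>0 < l\<close> gc[of t] c g0[of t] by (intro mult_mono mult_left_mono trunc_weight_ge_1) auto
    then show "l * c \<le> w t" using w(2)[of t] by simp
  qed
  have "l < \<Lambda>"
  proof (rule ccontr)
    assume "\<not> l < \<Lambda>"
    with l have "l = \<Lambda>" by simp
    then have "support 0 \<le> s" using l_eq \<Lambda>0 unfolding h0 clamp_to_def by (auto simp: max_def min_def split: if_splits)
    with \<open>l * c \<le> support 0\<close> s s12 have "\<Lambda> * c \<le> 12 / c" unfolding \<open>l = \<Lambda>\<close> by simp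
    moreover have "\<Lambda> * c = 12 / c + c" using c by (simp add: \<Lambda>_def distrib_right power2_eq_square)
    ultimately show False using c by linarith
  qed
  with \<open>0 < l\<close> l_eq have "s = support 0" unfolding h0 clamp_to_def by (auto simp: max_def min_def split: if_splits)
  with s_eq have "support 0 = clamp_to s1 s2 (support 0 + \<sigma> * (l - 1))" by simp
  then show ?thesis using that w \<open>0 < l\<close> unfolding R_def by blast
qed

section \<open>Two solutions\<close>

lemma sqrt_half_pi_le: "sqrt (pi / 2) \<le> (6267/5000)"
proof (rule real_le_lsqrt)
  have "pi \<le> (3927/1250)" using pi_approx by simp
  then show "pi / 2 \<le> (6267/5000)\<^sup>2" by (simp add: power2_eq_square)
qed simp

text \<open>The hypotheses are \<open>half_gauss_length_lower_bounds\<close> for support values \<open>4/5\<close> and \<open>L\<close> in perpendicular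
  directions. The first bound serves for small \<open>L\<close>, the second for large \<open>L\<close>, and the third in between,
  where three subintervals suffice; the number \<open>6267/5000 = 1.2534\<close> is just above \<open>sqrt (\<pi>/2)\<close>.\<close>

lemma separation_numeric:
  assumes L: "0 \<le> L"
    and P: "exp (- L\<^sup>2 / 2) * (2 * gauss_primitive (4/5)) \<le> q"
    and Q: "exp (- (4/5)\<^sup>2 / 2) * (2 * gauss_primitive L) \<le> q"
    and PQ: "exp (- L\<^sup>2 / 2) * (2 * gauss_primitive (4/5)) + exp (- (4/5)\<^sup>2 / 2) * (2 * gauss_primitive L) \<le> sqrt 2 * q"
  shows "(6267/5000) \<le> q"
proof -
  have G: "(14293/10000) \<le> 2 * gauss_primitive (4/5)" using gauss_primitive_ge[of "4/5"] by (simp add: power3_eq_cube)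
  (* (1 - x/32)^32 is below exp (- x) and close enough to it for the margins in all cases. *)
  have E: "(1 - b\<^sup>2 / 64) ^ 32 \<le> exp (- L\<^sup>2 / 2)" if "L \<le> b" "b \<le> 2" for b
  proof -
    have b2: "L\<^sup>2 \<le> b\<^sup>2" "b\<^sup>2 \<le> 2\<^sup>2" using L that by (intro power_mono; simp)+
    have "(1 - (b\<^sup>2 / 2) / real 32) ^ 32 \<le> exp (- (b\<^sup>2 / 2))"
      by (rule exp_ge_one_minus_x_over_n_power_n) (use b2 in auto)
    also have "\<dots> \<le> exp (- L\<^sup>2 / 2)" using b2 by simp
    finally show ?thesis by simp
  qed
  have E45: "(7249/10000) \<le> exp (- (4/5)\<^sup>2 / (2::real))"
  proof -
    have "(1 - ((4/5)\<^sup>2 / 2) / real 32) ^ 32 \<le> exp (- ((4/5)\<^sup>2 / 2))"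
      by (rule exp_ge_one_minus_x_over_n_power_n) (auto simp: power2_eq_square)
    moreover have "(7249/10000) \<le> (1 - ((4/5)\<^sup>2 / 2) / real 32) ^ 32"
      by (simp add: power2_eq_square power_divide)
    ultimately show ?thesis by simp
  qed
  have lowP: "e * (14293/10000) \<le> exp (- L\<^sup>2 / 2) * (2 * gauss_primitive (4/5))" if "e \<le> exp (- L\<^sup>2 / 2)" for e
    using that G by (intro mult_mono) auto
  have lowQ: "(7249/10000) * (2 * (a - a ^ 3 / 6)) \<le> exp (- (4/5)\<^sup>2 / 2) * (2 * gauss_primitive L)" if "0 \<le> a" "a \<le> 2" "a \<le> L" for a
  proof -
    have "a ^ 3 \<le> 4 * a" using that power_mono[of a 2 2] by (simp add: power3_eq_cube power2_eq_square mult_right_mono)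
    then have "0 \<le> a - a ^ 3 / 6" using that by simp
    then show ?thesis
      using E45 gauss_primitive_ge[OF that(1)] gauss_primitive_mono[OF that(3)] by (intro mult_mono) auto
  qed
  have s2: "sqrt 2 \<le> (70711/50000)" by (rule real_le_lsqrt) (auto simp: power2_eq_square)
  have comb: "(6267/5000) \<le> q" if "(8863/5000) \<le> sqrt 2 * q"
  proof -
    have "0 < sqrt 2 * q" using that by linarith
    then have "0 < q" by (simp add: zero_less_mult_iff)
    then have "sqrt 2 * q \<le> (70711/50000) * q" using s2 by (intro mult_right_mono) auto
    with that show ?thesis by simp
  qed
  consider "L \<le> 1/2" | "1/2 \<le> L" "L \<le> 18/25" | "18/25 \<le> L" "L \<le> (19/20)" | "(19/20) \<le> L" "L \<le> (27/25)" | "(27/25) \<le> L"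
    by linarith
  then show ?thesis
  proof cases
    case 1
    have "(439/500) \<le> exp (- L\<^sup>2 / 2)" using E[OF 1] by (simp add: power2_eq_square power_divide)
    from lowP[OF this] P show ?thesis by simp
  next
    case 2
    have "(77/100) \<le> exp (- L\<^sup>2 / 2)" using E[OF 2(2)] by (simp add: power2_eq_square power_divide)
    from lowP[OF this] lowQ[of "1/2"] 2 PQ show ?thesis by (intro comb) (simp add: power3_eq_cube)
  next
    case 3
    have "(63/100) \<le> exp (- L\<^sup>2 / 2)" using E[OF 3(2)] by (simp add: power2_eq_square power_divide)
    from lowP[OF this] lowQ[of "18/25"] 3 PQ show ?thesis by (intro comb) (simp add: power3_eq_cube)
  next
    case 4
    have "(11/20) \<le> exp (- L\<^sup>2 / 2)" using E[OF 4(2)] by (simp add: power2_eq_square power_divide)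
    from lowP[OF this] lowQ[of "(19/20)"] 4 PQ show ?thesis by (intro comb) (simp add: power3_eq_cube)
  next
    case 5
    from lowQ[of "(27/25)"] 5 Q show ?thesis by (simp add: power3_eq_cube)
  qed
qed

theorem two_radius_functions:
  assumes g [measurable]: "g \<in> borel_measurable borel"
    and c: "0 < c" and gc: "\<And>t. c \<le> g t" and gC: "\<And>t. g t \<le> C" and gp: "\<And>t. g (t + pi) = g t"
    and small: "integral {0..pi} g < sqrt (pi / 2)"
  shows "\<exists>w1 B1 w2 B2. radius_function w1 B1 \<and> radius_function w2 B2
    \<and> (\<forall>t. w1 t = g t * exp ((norm (radius_function.curve w1 t))\<^sup>2 / 2))
    \<and> (\<forall>t. w2 t = g t * exp ((norm (radius_function.curve w2 t))\<^sup>2 / 2))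
    \<and> radius_function.support w1 0 < radius_function.support w2 0"
proof -
  have g0: "0 \<le> g t" for t using gc[of t] c by linarith
  have gi: "g integrable_on {0..pi}"
    by (rule bounded_borel_integrable[where B = C]) (use g0 gC in auto)
  have "pi * c \<le> integral {0..pi} g"
    using integral_le[OF integrable_const_ivl gi, of c] gc by simp
  then have "pi * c < (6267/5000)" using small sqrt_half_pi_le by linarith
  moreover have "3 * c \<le> pi * c" using pi_gt3 c by (intro mult_right_mono) auto
  ultimately have c1: "c < 1" by linarith
  have R0: "0 \<le> 12 / c" using c by simp
  (* The three comparisons of l with 1, and the removal of the truncation when l = 1. *)
  have key: "(h0 = c / 2 \<longrightarrow> l < 1) \<and> (h0 = 4/5 \<longrightarrow> 1 < l) \<and> (h0 = 12 / c \<longrightarrow> l < 1)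
    \<and> (h0 \<le> 12 / c \<longrightarrow> l = 1 \<longrightarrow> (\<forall>t. w t = g t * exp ((norm (radius_function.curve w t))\<^sup>2 / 2)))"
    if rf: "radius_function w B" and l: "0 < l" and h0: "h0 = radius_function.support w 0"
      and w: "\<And>t. w t = l * g t * trunc_weight (12 / c) (radius_function.curve w t)" for w B l h0
  proof -
    interpret radius_function w B by (rule rf)
    have lc: "l * c \<le> support 0"
    proof (rule support_ge_of_w_ge)
      fix t
      have "(l * c) * 1 \<le> (l * g t) * trunc_weight (12 / c) (curve t)"
        using l gc[of t] c g0[of t] by (intro mult_mono mult_left_mono trunc_weight_ge_1) auto
      then show "l * c \<le> w t" using w[of t] by simp
    qed
    have bound: "norm (curve t) \<le> 11 / c" if "1 \<le> l" "support 0 \<le> 12 / c" for t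
    proof (rule a_priori_bound[OF c _ that(2)])
      fix t
      have "(1 * c) * trunc_weight (12 / c) (curve t) \<le> (l * g t) * trunc_weight (12 / c) (curve t)"
        using that gc[of t] c order_trans[OF zero_le_one trunc_weight_ge_1] by (intro mult_right_mono mult_mono) auto
      then show "c * exp ((min (norm (curve t)) (12 / c))\<^sup>2 / 2) \<le> w t"
        using w[of t] by (simp add: trunc_weight_def)
    qed
    have 1: "l < 1" if "h0 = c / 2"
    proof -
      have "l * c \<le> (1/2) * c" using lc that unfolding h0 by simp
      then show ?thesis using c by simp
    qed
    have 3: "l < 1" if "h0 = 12 / c"
    proof (rule ccontr)
      assume "\<not> l < 1"
      then have "support 0 \<le> 11 / c" using bound[of 0] that support_le_norm[of 0] unfolding h0 by simp
      then show False using that c unfolding h0 by (simp add: field_simps)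
    qed
    have 2: "1 < l" if "h0 = 4/5"
    proof -
      have "(6267/5000) \<le> half_gauss_length 0"
        using separation_numeric[OF support_nonneg[of "pi/2"], of "half_gauss_length 0"] half_gauss_length_lower_bounds[of 0] that unfolding h0 by simp
      also have "half_gauss_length 0 \<le> integral {0..pi} (\<lambda>s. l * g s)"
        unfolding half_gauss_length_def add_0
      proof (rule integral_le[OF integrable_half_gauss_length])
        show "(\<lambda>s. l * g s) integrable_on {0..pi}" by (rule integrable_on_mult_right[OF gi])
        fix s
        have "w s * exp (- (norm (curve s))\<^sup>2 / 2) \<le> (l * g s * exp ((norm (curve s))\<^sup>2 / 2)) * exp (- (norm (curve s))\<^sup>2 / 2)"
          unfolding w[of s] using l g0[of s] R0 by (intro mult_right_mono mult_left_mono trunc_weight_le_exp) auto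
        also have "\<dots> = l * g s" by (simp add: mult.assoc exp_add[symmetric])
        finally show "w s * exp (- (norm (curve s))\<^sup>2 / 2) \<le> l * g s" .
      qed
      also have "\<dots> = l * integral {0..pi} g" by simp
      also have "\<dots> < l * sqrt (pi / 2)" using small l by simp
      also have "\<dots> \<le> l * (6267/5000)" using sqrt_half_pi_le l by (intro mult_left_mono) auto
      finally show "1 < l" by simp
    qed
    have 4: "w t = g t * exp ((norm (curve t))\<^sup>2 / 2)" if "h0 \<le> 12 / c" "l = 1" for t
    proof -
      have "norm (curve t) \<le> 12 / c" using bound[of t] that c unfolding h0 by (simp add: field_simps)
      then show ?thesis using w[of t] that by (simp add: trunc_weight_eq)
    qed
    from 1 2 3 4 show ?thesis by blast
  qed
  have r: "0 < c / 2" "c / 2 < 4 / 5" "4 / 5 < 12 / c" using c c1 by (auto simp: field_simps)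
  (* The small solution. *)
  obtain w B l where w: "radius_function w B" "0 < l"
    "\<And>t. w t = l * g t * trunc_weight (12 / c) (radius_function.curve w t)"
    and cl: "radius_function.support w 0 = clamp_to (c/2) (4/5) (radius_function.support w 0 + (-1) * (l - 1))"
    by (rule shooting[OF g c gc gC gp, of "c/2" "4/5" "-1"]) (use r in auto)
  (* The large solution. *)
  obtain w' B' l' where w': "radius_function w' B'" "0 < l'"
    "\<And>t. w' t = l' * g t * trunc_weight (12 / c) (radius_function.curve w' t)"
    and cl': "radius_function.support w' 0 = clamp_to (4/5) (12/c) (radius_function.support w' 0 + 1 * (l' - 1))"
    by (rule shooting[OF g c gc gC gp, of "4/5" "12/c" 1]) (use r in auto)
  note K = key[OF w(1,2) refl w(3)] and K' = key[OF w'(1,2) refl w'(3)]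
  let ?support = "radius_function.support w 0" and ?support' = "radius_function.support w' 0"
  have range: "c / 2 \<le> ?support" "?support \<le> 4/5" "4/5 \<le> ?support'" "?support' \<le> 12 / c"
    using clamp_to_in[of "c/2" "4/5" "?support + (-1) * (l - 1)"] clamp_to_in[of "4/5" "12/c" "?support' + 1 * (l' - 1)"] r
    unfolding cl[symmetric] cl'[symmetric] by auto
  have A: "l = 1 \<and> ?support < 4/5"
    using K range r cl unfolding clamp_to_def by (auto simp: max_def min_def split: if_splits)
  have A': "l' = 1 \<and> 4/5 < ?support'"
    using K' range r cl' unfolding clamp_to_def by (auto simp: max_def min_def split: if_splits)
  have "?support \<le> 12 / c" using range r by linarith
  with A A' K K' range w(1) w'(1) show ?thesis
    by (intro exI[of _ w] exI[of _ B] exI[of _ w'] exI[of _ B']) auto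
qed

section \<open>One-dimensional Hausdorff measure\<close>

lemma hausdorff1_content_mono: "A \<subseteq> A' \<Longrightarrow> hausdorff1_content \<delta> A \<le> hausdorff1_content \<delta> A'"
  unfolding hausdorff1_content_def by (rule INF_superset_mono) auto

lemma hausdorff1_content_antimono: "\<delta> \<le> \<delta>' \<Longrightarrow> hausdorff1_content \<delta>' A \<le> hausdorff1_content \<delta> A"
  unfolding hausdorff1_content_def by (rule INF_superset_mono) (auto intro: order_trans)

lemma hausdorff1_content_le:
  assumes "A \<subseteq> (\<Union>i. U i)" "\<And>i. bounded (U i)" "\<And>i. diameter (U i) \<le> \<delta>"
  shows "hausdorff1_content \<delta> A \<le> (\<Sum>i. ennreal (diameter (U i)))"
  unfolding hausdorff1_content_def by (rule INF_lower) (use assms in auto)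

lemma hausdorff1_content_countably_subadditive:
  fixes A :: "nat \<Rightarrow> 'a::metric_space set"
  shows "hausdorff1_content \<delta> (\<Union>n. A n) \<le> (\<Sum>n. hausdorff1_content \<delta> (A n))"
proof (rule ennreal_le_epsilon)
  fix e :: real assume e: "0 < e" and fin: "(\<Sum>n. hausdorff1_content \<delta> (A n)) < top"
  then have lt: "hausdorff1_content \<delta> (A n) < hausdorff1_content \<delta> (A n) + e * (1/2)^Suc n" for n
    by (auto simp add: less_top dest!: ennreal_suminf_lessD)
  have "\<exists>U :: nat \<Rightarrow> 'a set. A n \<subseteq> (\<Union>i. U i) \<and> (\<forall>i. bounded (U i) \<and> diameter (U i) \<le> \<delta>) \<and>
      (\<Sum>i. ennreal (diameter (U i))) < hausdorff1_content \<delta> (A n) + e * (1/2)^Suc n" for n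
    using lt[of n] unfolding hausdorff1_content_def[of \<delta> "A n"] INF_less_iff by auto
  then obtain U :: "nat \<Rightarrow> nat \<Rightarrow> 'a set" where U: "\<And>n. A n \<subseteq> (\<Union>i. U n i)" "\<And>n i. bounded (U n i)" "\<And>n i. diameter (U n i) \<le> \<delta>"
    "\<And>n. (\<Sum>i. ennreal (diameter (U n i))) < hausdorff1_content \<delta> (A n) + e * (1/2)^Suc n"
    by metis
  define C where "C = case_prod U o prod_decode"
  have "(\<Union>n. A n) \<subseteq> (\<Union>i. C i)"
    using U(1) by (auto simp add: C_def subset_eq) (metis prod.case prod_encode_inverse)
  then have "hausdorff1_content \<delta> (\<Union>n. A n) \<le> (\<Sum>i. ennreal (diameter (C i)))"
    by (rule hausdorff1_content_le) (auto simp: C_def U split: prod.split)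
  also have "\<dots> = (\<Sum>n. \<Sum>i. ennreal (diameter (U n i)))"
    using suminf_ennreal_2dimen[of "\<lambda>n. \<Sum>i. ennreal (diameter (U n i))" "\<lambda>(n, i). ennreal (diameter (U n i))"]
    unfolding C_def comp_def by (simp add: case_prod_unfold)
  also have "\<dots> \<le> (\<Sum>n. hausdorff1_content \<delta> (A n) + e * (1/2) ^ Suc n)"
    by (intro suminf_le allI less_imp_le U(4)) auto
  also have "\<dots> = (\<Sum>n. hausdorff1_content \<delta> (A n)) + (\<Sum>n. ennreal e * ennreal ((1/2) ^ Suc n))"
    using e by (subst suminf_add[symmetric]) (auto simp del: ennreal_suminf_cmult simp add: ennreal_mult[symmetric])
  also have "\<dots> = (\<Sum>n. hausdorff1_content \<delta> (A n)) + e"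
    unfolding ennreal_suminf_cmult by (subst suminf_ennreal_eq[OF zero_le_power power_half_series]) auto
  finally show "hausdorff1_content \<delta> (\<Union>n. A n) \<le> (\<Sum>n. hausdorff1_content \<delta> (A n)) + e" .
qed

lemma hausdorff1_content_le_outer: "0 < \<delta> \<Longrightarrow> hausdorff1_content \<delta> A \<le> hausdorff1_outer A"
  unfolding hausdorff1_outer_def by (rule SUP_upper) simp

lemma hausdorff1_outer_mono: "A \<subseteq> A' \<Longrightarrow> hausdorff1_outer A \<le> hausdorff1_outer A'"
  unfolding hausdorff1_outer_def by (rule SUP_mono) (auto intro: hausdorff1_content_mono)

lemma hausdorff1_outer_empty [simp]: "hausdorff1_outer {} = 0"
proof -
  have "hausdorff1_content \<delta> {} \<le> 0" if "0 < \<delta>" for \<delta>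
    using hausdorff1_content_le[of "{}" "\<lambda>_. {}" \<delta>] that by simp
  then have "hausdorff1_outer {} \<le> 0"
    unfolding hausdorff1_outer_def by (intro SUP_least) auto
  then show ?thesis by simp
qed

lemma hausdorff1_outer_countably_subadditive:
  "hausdorff1_outer (\<Union>n. A n) \<le> (\<Sum>n. hausdorff1_outer (A n))"
  unfolding hausdorff1_outer_def[of "\<Union>n. A n"]
proof (rule SUP_least)
  fix \<delta> :: real assume "\<delta> \<in> {0<..}"
  then show "hausdorff1_content \<delta> (\<Union>n. A n) \<le> (\<Sum>n. hausdorff1_outer (A n))"
    by (intro order_trans[OF hausdorff1_content_countably_subadditive] suminf_le hausdorff1_content_le_outer) auto
qed

lemma hausdorff1_outer_subadditive:
  "hausdorff1_outer (A \<union> B) \<le> hausdorff1_outer A + hausdorff1_outer B"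
proof -
  let ?A = "\<lambda>n::nat. if n = 0 then A else if n = 1 then B else {}"
  have "(\<Union>n. ?A n) = A \<union> B" by (auto split: if_splits)
  moreover have "(\<Sum>n. hausdorff1_outer (?A n)) = (\<Sum>n\<in>{0,1}. hausdorff1_outer (?A n))"
    by (rule suminf_finite) auto
  ultimately show ?thesis using hausdorff1_outer_countably_subadditive[of ?A] by simp
qed

text \<open>A set of diameter less than the distance between \<open>A\<close> and \<open>B\<close> meets only one of them, so every fine
  cover splits into a cover of \<open>A\<close> and a cover of \<open>B\<close>.\<close>

lemma hausdorff1_outer_separated:
  assumes \<rho>: "0 < \<rho>" and sep: "\<And>a b. a \<in> A \<Longrightarrow> b \<in> B \<Longrightarrow> \<rho> \<le> dist a b"
  shows "hausdorff1_outer A + hausdorff1_outer B \<le> hausdorff1_outer (A \<union> B)"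
proof -
  have small: "hausdorff1_content \<delta> A + hausdorff1_content \<delta> B \<le> hausdorff1_content \<delta> (A \<union> B)"
    if \<delta>: "0 < \<delta>" "\<delta> < \<rho>" for \<delta>
    unfolding hausdorff1_content_def[of \<delta> "A \<union> B"]
  proof (rule INF_greatest, elim CollectE conjE)
    fix U :: "nat \<Rightarrow> 'a set"
    assume cov: "A \<union> B \<subseteq> (\<Union>i. U i)" and U: "\<forall>i. bounded (U i) \<and> diameter (U i) \<le> \<delta>"
    define V where "V i = (if U i \<inter> A \<noteq> {} then U i else {})" for i
    define W where "W i = (if U i \<inter> A = {} then U i else {})" for i
    have "A \<subseteq> (\<Union>i. V i)" using cov by (fastforce simp: V_def)
    then have "hausdorff1_content \<delta> A \<le> (\<Sum>i. ennreal (diameter (V i)))"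
      by (rule hausdorff1_content_le) (use U \<delta> in \<open>auto simp: V_def\<close>)
    moreover have "B \<subseteq> (\<Union>i. W i)"
    proof
      fix b assume b: "b \<in> B"
      then obtain i where i: "b \<in> U i" using cov by auto
      have "U i \<inter> A = {}"
      proof (rule ccontr)
        assume "U i \<inter> A \<noteq> {}"
        then obtain a where "a \<in> U i" "a \<in> A" by auto
        then have "dist a b \<le> \<delta>" using diameter_bounded_bound[of "U i" a b] U i by (auto intro: order_trans)
        then show False using sep[OF \<open>a \<in> A\<close> b] \<delta> by simp
      qed
      then show "b \<in> (\<Union>i. W i)" using i by (auto simp: W_def)
    qed
    then have "hausdorff1_content \<delta> B \<le> (\<Sum>i. ennreal (diameter (W i)))"
      by (rule hausdorff1_content_le) (use U \<delta> in \<open>auto simp: W_def\<close>)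
    ultimately have "hausdorff1_content \<delta> A + hausdorff1_content \<delta> B
        \<le> (\<Sum>i. ennreal (diameter (V i))) + (\<Sum>i. ennreal (diameter (W i)))"
      by (rule add_mono)
    also have "\<dots> = (\<Sum>i. ennreal (diameter (V i)) + ennreal (diameter (W i)))"
      by (rule suminf_add) auto
    also have "(\<lambda>i. ennreal (diameter (V i)) + ennreal (diameter (W i))) = (\<lambda>i. ennreal (diameter (U i)))"
      by (auto simp: V_def W_def fun_eq_iff)
    finally show "hausdorff1_content \<delta> A + hausdorff1_content \<delta> B \<le> (\<Sum>i. ennreal (diameter (U i)))" .
  qed
  have *: "hausdorff1_content \<delta> A + hausdorff1_content \<delta>' B \<le> hausdorff1_outer (A \<union> B)" if "0 < \<delta>" "0 < \<delta>'" for \<delta> \<delta>'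
  proof -
    define r where "r = min (min \<delta> \<delta>') (\<rho> / 2)"
    have r: "0 < r" "r < \<rho>" "r \<le> \<delta>" "r \<le> \<delta>'" using that \<rho> by (auto simp: r_def)
    have "hausdorff1_content \<delta> A + hausdorff1_content \<delta>' B \<le> hausdorff1_content r A + hausdorff1_content r B"
      by (intro add_mono hausdorff1_content_antimono r)
    also have "\<dots> \<le> hausdorff1_outer (A \<union> B)"
      using small[OF r(1,2)] hausdorff1_content_le_outer[OF r(1), of "A \<union> B"] by (rule order_trans)
    finally show ?thesis .
  qed
  have ne: "{0 :: real<..} \<noteq> {}" by (rule greaterThan_non_empty)
  have **: "hausdorff1_content \<delta> A + hausdorff1_outer B \<le> hausdorff1_outer (A \<union> B)" if "0 < \<delta>" for \<delta>
  proof -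
    have "hausdorff1_content \<delta> A + hausdorff1_outer B = (SUP \<delta>'\<in>{0<..}. hausdorff1_content \<delta> A + hausdorff1_content \<delta>' B)"
      unfolding hausdorff1_outer_def by (rule ennreal_SUP_add_right[OF ne])
    also have "\<dots> \<le> hausdorff1_outer (A \<union> B)"
      by (rule SUP_least) (rule *[OF that], simp)
    finally show ?thesis .
  qed
  have "hausdorff1_outer A + hausdorff1_outer B = (SUP \<delta>\<in>{0<..}. hausdorff1_content \<delta> A + hausdorff1_outer B)"
    unfolding hausdorff1_outer_def[of A] by (rule ennreal_SUP_add_left[OF ne, symmetric])
  also have "\<dots> \<le> hausdorff1_outer (A \<union> B)"
    by (rule SUP_least) (rule **, simp)
  finally show ?thesis .
qed

lemma outer_measure_space_hausdorff1: "outer_measure_space (UNIV :: 'a::metric_space set set) hausdorff1_outer"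
  unfolding outer_measure_space_def positive_def increasing_def countably_subadditive_def
  by (auto intro: hausdorff1_outer_mono hausdorff1_outer_countably_subadditive)

text \<open>Caratheodory's criterion. The part of \<open>X\<close> outside \<open>F\<close> is exhausted by the sets \<open>A n\<close> of points at
  distance at least \<open>1/(n+1)\<close> from \<open>F\<close>, which are separated from \<open>F\<close>. Shells \<open>R n\<close> and \<open>R (n + 2)\<close> are
  separated as well, so the sum over the even shells and the sum over the odd ones are both bounded by
  the measure of \<open>X\<close>, and the tail of the exhaustion is negligible.\<close>

lemma closed_in_lambda_system:
  fixes F :: "'a::metric_space set"
  assumes F: "closed F"
  shows "F \<in> lambda_system UNIV UNIV hausdorff1_outer"
proof -
  have main: "hausdorff1_outer (X \<inter> F) + hausdorff1_outer (X - F) \<le> hausdorff1_outer X" for X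
  proof (cases "hausdorff1_outer X = top")
    case False
    define A where "A n = {x \<in> X - F. \<forall>y\<in>F. 1 / real (Suc n) \<le> dist x y}" for n
    define R where "R n = A (Suc n) - A n" for n
    have AX: "A n \<subseteq> X - F" for n by (auto simp: A_def)
    have Amono: "A m \<subseteq> A n" if "m \<le> n" for m n
    proof -
      have "1 / real (Suc n) \<le> 1 / real (Suc m)" using that by (simp add: field_simps)
      then show ?thesis by (auto simp: A_def intro: order_trans)
    qed
    have RX: "R n \<subseteq> X" for n using AX by (auto simp: R_def)
    have Usum: "X - F \<subseteq> A n \<union> (\<Union>k. R (k + n))" for n
    proof
      fix x assume x: "x \<in> X - F"
      have "open (- F)" "x \<in> - F" using F x by auto
      then obtain e where e: "0 < e" "ball x e \<subseteq> - F" by (meson openE)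
      obtain N where N: "1 / real (Suc N) < e" using e(1) nat_approx_posE by blast
      have "x \<in> A N" using x e N by (force simp: A_def subset_eq not_less)
      then have ex: "\<exists>j. x \<in> A (j + n)" using Amono[of N "N + n"] by auto
      define j where "j = (LEAST j. x \<in> A (j + n))"
      have j: "x \<in> A (j + n)" unfolding j_def by (rule LeastI_ex[OF ex])
      show "x \<in> A n \<union> (\<Union>k. R (k + n))"
      proof (cases j)
        case (Suc i)
        then have "x \<notin> A (i + n)" unfolding j_def using not_less_Least[of i "\<lambda>j. x \<in> A (j + n)"] by simp
        then show ?thesis using j Suc by (auto simp: R_def)
      qed (use j in simp)
    qed
    have gap: "1 / real (Suc (Suc n)) - 1 / real (Suc (Suc (Suc n))) \<le> dist x y" if x: "x \<in> A (Suc n)" and y: "y \<in> R (n + 2)" for x y n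
    proof -
      obtain z where z: "z \<in> F" "dist y z < 1 / real (Suc (Suc (Suc n)))" 
        using y AX[of "Suc (n+2)"] by (auto simp: R_def A_def not_le)
      have "1 / real (Suc (Suc n)) \<le> dist x z" using x z by (auto simp: A_def)
      also have "\<dots> \<le> dist x y + dist y z" by (rule dist_triangle)
      finally show ?thesis using z by linarith
    qed
    have gap_pos: "0 < 1 / real (Suc (Suc n)) - 1 / real (Suc (Suc (Suc n)))" for n
      using divide_strict_left_mono[of "real (Suc (Suc n))" "real (Suc (Suc (Suc n)))" 1] by simp
    have partial: "(\<Sum>k<N. hausdorff1_outer (R (2 * k + d))) \<le> hausdorff1_outer (\<Union>k\<in>{..<N}. R (2 * k + d))" for N d
    proof (induction N)
      case (Suc N)
      have "(\<Sum>k<Suc N. hausdorff1_outer (R (2 * k + d))) \<le> hausdorff1_outer (\<Union>k\<in>{..<N}. R (2 * k + d)) + hausdorff1_outer (R (2 * N + d))"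
        using Suc by (simp add: add_right_mono)
      also have "\<dots> \<le> hausdorff1_outer ((\<Union>k\<in>{..<N}. R (2 * k + d)) \<union> R (2 * N + d))"
      proof (cases N)
        case (Suc M)
        show ?thesis
        proof (rule hausdorff1_outer_separated[OF gap_pos[of "2 * M + d"]])
          fix x y assume "x \<in> (\<Union>k\<in>{..<N}. R (2 * k + d))" and y: "y \<in> R (2 * N + d)"
          then obtain k where "k < N" "x \<in> A (Suc (2 * k + d))" by (auto simp: R_def)
          then have "x \<in> A (Suc (2 * M + d))" using Suc Amono[of "Suc (2 * k + d)" "Suc (2 * M + d)"] by auto
          moreover have "y \<in> R (2 * M + d + 2)" using y Suc by simp
          ultimately show "1 / real (Suc (Suc (2 * M + d))) - 1 / real (Suc (Suc (Suc (2 * M + d)))) \<le> dist x y"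
            by (rule gap)
        qed
      qed simp
      also have "\<dots> = hausdorff1_outer (\<Union>k\<in>{..<Suc N}. R (2 * k + d))" by (simp add: lessThan_Suc Un_commute)
      finally show ?case .
    qed simp
    have fin: "hausdorff1_outer (R n) < top" for n
      using hausdorff1_outer_mono[OF RX[of n]] False by (simp add: less_top order_le_less_trans)
    (* Real values, so that the tail of the convergent series can be made small. *)
    define r where "r n = enn2real (hausdorff1_outer (R n))" for n
    have r: "hausdorff1_outer (R n) = ennreal (r n)" "0 \<le> r n" for n
      using fin[of n] by (auto simp: r_def)
    obtain H where H: "hausdorff1_outer X = ennreal H" "0 \<le> H" using False by (metis ennreal_cases)
    have sumr: "summable r"
    proof (rule summableI_nonneg_bounded)
      fix n
      have half': "(\<Sum>k<N. r (2 * k + d)) \<le> H" for N d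
      proof -
        have "ennreal (\<Sum>k<N. r (2 * k + d)) = (\<Sum>k<N. hausdorff1_outer (R (2 * k + d)))"
          by (simp add: r sum_ennreal)
        also have "\<dots> \<le> ennreal H"
          unfolding H(1)[symmetric]
          by (rule order_trans[OF partial hausdorff1_outer_mono]) (use RX in blast)
        finally show ?thesis using H by simp
      qed
      have "(\<Sum>k<n. r k) \<le> (\<Sum>k<2*n. r k)" by (rule sum_mono2) (auto simp: r)
      also have "\<dots> = (\<Sum>k<n. r (2 * k)) + (\<Sum>k<n. r (2 * k + 1))" by (induction n) auto
      also have "\<dots> \<le> 2 * H" using half'[where N = n and d = 0] half'[where N = n and d = 1] by simp
      finally show "(\<Sum>k<n. r k) \<le> 2 * H" .
    qed (rule r)
    show ?thesis
    proof (rule ennreal_le_epsilon)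
      fix e :: real assume e: "0 < e"
      obtain n where n: "norm (\<Sum>k. r (k + n)) < e" using suminf_exist_split[OF e sumr] by blast
      have tail: "(\<Sum>k. hausdorff1_outer (R (k + n))) \<le> ennreal e"
      proof -
        have "(\<Sum>k. hausdorff1_outer (R (k + n))) = ennreal (\<Sum>k. r (k + n))"
          unfolding r using sumr r by (intro suminf_ennreal2) (auto simp: summable_iff_shift)
        then show ?thesis using n by (simp add: ennreal_leI)
      qed
      have "hausdorff1_outer (X - F) \<le> hausdorff1_outer (A n) + hausdorff1_outer (\<Union>k. R (k + n))"
        using hausdorff1_outer_mono[OF Usum] hausdorff1_outer_subadditive by (rule order_trans)
      also have "\<dots> \<le> hausdorff1_outer (A n) + ennreal e"
        using hausdorff1_outer_countably_subadditive[of "\<lambda>k. R (k + n)"] tail by (intro add_left_mono) (rule order_trans)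
      finally have "hausdorff1_outer (X \<inter> F) + hausdorff1_outer (X - F) \<le> (hausdorff1_outer (X \<inter> F) + hausdorff1_outer (A n)) + ennreal e"
        by (simp add: add.assoc add_left_mono)
      also have "hausdorff1_outer (X \<inter> F) + hausdorff1_outer (A n) \<le> hausdorff1_outer ((X \<inter> F) \<union> A n)"
        by (rule hausdorff1_outer_separated[of "1 / real (Suc n)"]) (auto simp: A_def dist_commute)
      also have "\<dots> \<le> hausdorff1_outer X" using AX by (intro hausdorff1_outer_mono) auto
      finally show "hausdorff1_outer (X \<inter> F) + hausdorff1_outer (X - F) \<le> hausdorff1_outer X + ennreal e"
        by (simp add: add_right_mono)
    qed
  qed simp
  have "hausdorff1_outer (F \<inter> X) + hausdorff1_outer ((UNIV - F) \<inter> X) = hausdorff1_outer X" for X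
  proof (rule antisym)
    have "F \<inter> X = X \<inter> F" "(UNIV - F) \<inter> X = X - F" by auto
    then show "hausdorff1_outer (F \<inter> X) + hausdorff1_outer ((UNIV - F) \<inter> X) \<le> hausdorff1_outer X" using main by simp
    have "X = (F \<inter> X) \<union> ((UNIV - F) \<inter> X)" by auto
    then show "hausdorff1_outer X \<le> hausdorff1_outer (F \<inter> X) + hausdorff1_outer ((UNIV - F) \<inter> X)"
      using hausdorff1_outer_subadditive by metis
  qed
  then show ?thesis by (simp add: lambda_system_def)
qed

lemma hausdorff1_measure_space:
  "measure_space UNIV (lambda_system UNIV (UNIV :: 'a::metric_space set set) hausdorff1_outer) hausdorff1_outer"
proof -
  interpret sigma_algebra UNIV "UNIV :: 'a set set"
    using sigma_algebra_Pow[of "UNIV :: 'a set"] by simp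
  show ?thesis by (rule caratheodory_lemma[OF outer_measure_space_hausdorff1])
qed

lemma space_hausdorff1 [simp]: "space hausdorff1 = UNIV"
  unfolding hausdorff1_def by (simp add: space_measure_of_conv)

lemma sets_hausdorff1: "sets hausdorff1 = lambda_system UNIV (UNIV :: 'a::metric_space set set) hausdorff1_outer"
proof -
  interpret sigma_algebra UNIV "lambda_system UNIV (UNIV :: 'a set set) hausdorff1_outer"
    using hausdorff1_measure_space[where 'a = 'a] by (simp add: measure_space_def)
  show ?thesis unfolding hausdorff1_def by (simp add: sets_measure_of sigma_sets_eq)
qed

lemma sets_borel_subset_hausdorff1: "sets borel \<subseteq> sets (hausdorff1 :: 'a::metric_space measure)"
proof -
  have "sigma_sets UNIV (Collect closed) \<subseteq> sets (hausdorff1 :: 'a measure)"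
    using closed_in_lambda_system sets.sigma_sets_subset[of "Collect closed" "hausdorff1 :: 'a measure"]
    by (auto simp: sets_hausdorff1)
  then show ?thesis by (simp add: borel_eq_closed)
qed

lemma borel_sets_hausdorff1 [measurable, simp]: "A \<in> sets borel \<Longrightarrow> A \<in> sets hausdorff1"
  using sets_borel_subset_hausdorff1 by blast

lemma emeasure_hausdorff1:
  assumes "A \<in> sets hausdorff1"
  shows "emeasure hausdorff1 A = hausdorff1_outer A"
proof -
  have ms: "measure_space UNIV (lambda_system UNIV (UNIV :: 'a set set) hausdorff1_outer) hausdorff1_outer"
    by (rule hausdorff1_measure_space)
  show ?thesis
    using assms ms unfolding sets_hausdorff1
    by (subst hausdorff1_def, intro emeasure_measure_of_sigma) (auto simp: measure_space_def)
qed

text \<open>A nonexpanding map to the line takes a cover to a cover by intervals that are no longer, and Lebesgue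
  measure is countably subadditive.\<close>

lemma hausdorff1_outer_ge_projection:
  fixes p :: "'a::metric_space \<Rightarrow> real"
  assumes lip: "\<And>x y. \<bar>p x - p y\<bar> \<le> dist x y" and sub: "{a..b} \<subseteq> p ` A"
  shows "ennreal (b - a) \<le> hausdorff1_outer A"
proof -
  have "ennreal (b - a) \<le> hausdorff1_content 1 A"
    unfolding hausdorff1_content_def
  proof (rule INF_greatest, elim CollectE conjE)
    fix U :: "nat \<Rightarrow> 'a set"
    assume cov: "A \<subseteq> (\<Union>i. U i)" and U: "\<forall>i. bounded (U i) \<and> diameter (U i) \<le> 1"
    define J where "J i = (if U i = {} then {} else {Inf (p ` U i)..Sup (p ` U i)})" for i
    have bd: "p x - p y \<le> diameter (U i)" if "x \<in> U i" "y \<in> U i" for x y i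
      using lip[of x y] diameter_bounded_bound[of "U i" x y] U that by force
    have bb: "bdd_above (p ` U i)" "bdd_below (p ` U i)" for i
    proof -
      show "bdd_above (p ` U i)"
      proof (cases "U i = {}")
        case False
        then obtain y where "y \<in> U i" by auto
        then show ?thesis using bd[of _ i y] by (intro bdd_aboveI[of _ "p y + diameter (U i)"]) force
      qed simp
      show "bdd_below (p ` U i)"
      proof (cases "U i = {}")
        case False
        then obtain y where "y \<in> U i" by auto
        then show ?thesis using bd[of y i] by (intro bdd_belowI[of _ "p y - diameter (U i)"]) force
      qed simp
    qed
    have Jlen: "emeasure lborel (J i) \<le> ennreal (diameter (U i))" for i
    proof (cases "U i = {}")
      case False
      have "Sup (p ` U i) - diameter (U i) \<le> Inf (p ` U i)"
      proof (rule cInf_greatest)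
        show "p ` U i \<noteq> {}" using False by simp
        fix z assume "z \<in> p ` U i"
        then obtain y where y: "y \<in> U i" "z = p y" by auto
        have "Sup (p ` U i) \<le> z + diameter (U i)"
          by (rule cSup_least) (use False y bd[of _ i y] in force)+
        then show "Sup (p ` U i) - diameter (U i) \<le> z" by simp
      qed
      moreover have "Inf (p ` U i) \<le> Sup (p ` U i)" using False bb[of i] by (intro cInf_le_cSup) auto
      ultimately show ?thesis using False by (simp add: J_def emeasure_lborel_Icc_eq ennreal_leI)
    qed (simp add: J_def)
    have "{a..b} \<subseteq> (\<Union>i. J i)"
    proof
      fix z assume "z \<in> {a..b}"
      then obtain x i where "x \<in> U i" "z = p x" using sub cov by blast
      then have "z \<in> J i" using bb[of i] by (auto simp: J_def intro!: cInf_lower cSup_upper)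
      then show "z \<in> (\<Union>i. J i)" by blast
    qed
    then have "emeasure lborel {a..b} \<le> emeasure lborel (\<Union>i. J i)" by (intro emeasure_mono) (auto simp: J_def)
    also have "\<dots> \<le> (\<Sum>i. emeasure lborel (J i))" by (rule emeasure_subadditive_countably) (auto simp: J_def)
    also have "\<dots> \<le> (\<Sum>i. ennreal (diameter (U i)))" by (intro suminf_le Jlen) auto
    finally show "ennreal (b - a) \<le> (\<Sum>i. ennreal (diameter (U i)))"
      by (cases "a \<le> b") (auto simp: ennreal_neg)
  qed
  then show ?thesis using hausdorff1_content_le_outer[of 1 A] by (auto intro: order_trans)
qed

section \<open>The convex body bounded by the curve\<close>

locale convex_curve = radius_function +
  fixes a :: real
  assumes a_pos: "0 < a" and w_ge: "\<And>t. a \<le> w t"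
begin

lemma curve_add_2pi: "curve (t + 2 * pi) = curve t"
  using curve_add_pi[of "t + pi"] curve_add_pi[of t] by (simp add: algebra_simps)

lemma support_ge: "a \<le> support t"
  by (rule support_ge_of_w_ge) (rule w_ge)

lemma abs_support_le: "\<bar>curve s \<bullet> dir t\<bar> \<le> support t"
proof -
  let ?f = "\<lambda>r. \<bar>curve (r + t) \<bullet> dir t\<bar>"
  have "curve (r + pi + t) = - curve (r + t)" for r
    using curve_add_pi[of "r + t"] by (simp add: algebra_simps)
  then have "?f (reduce_mod_pi (s - t)) = ?f (s - t)"
    by (intro periodic_reduce_mod_pi[where f = ?f]) simp
  moreover have "?f (reduce_mod_pi (s - t)) \<le> support t"
    using frame_coordinate_1[of t "reduce_mod_pi (s - t) + t"] reduce_mod_pi_bounds[of "s - t"] by simp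
  ultimately show ?thesis by simp
qed

text \<open>Strict because the radius of curvature is bounded below.\<close>

lemma height_drops:
  assumes "t < s" "s \<le> t + pi"
  shows "(curve s - curve t) \<bullet> dir t < 0"
proof -
  have i: "((\<lambda>r. sin (r - t)) has_integral (- cos (s - t) - - cos (t - t))) {t..s}"
    using assms by (intro fundamental_theorem_of_calculus)
       (auto intro!: derivative_eq_intros simp flip: has_real_derivative_iff_has_vector_derivative)
  have "cos (s - t) < 1"
    using cos_monotone_0_pi[of 0 "s - t"] assms by simp
  then have "0 < a * (1 - cos (s - t))" using a_pos by simp
  also have "\<dots> = integral {t..s} (\<lambda>r. a * sin (r - t))"
    using i by (simp add: integral_unique)
  also have "\<dots> \<le> integral {t..s} (\<lambda>r. w r * sin (r - t))"
  proof (rule integral_le)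
    show "(\<lambda>r. a * sin (r - t)) integrable_on {t..s}"
      using i by (intro integrable_on_mult_right) auto
    show "(\<lambda>r. w r * sin (r - t)) integrable_on {t..s}" by (rule integrable_w_mult[where C = 1]) auto
  qed (use assms in \<open>auto intro!: mult_right_mono w_ge sin_ge_zero\<close>)
  finally show ?thesis using curve_diff_inner(1)[of t s t] assms by simp
qed

lemma inj_on_curve: "inj_on curve {0..<2*pi}"
proof -
  have "curve s \<noteq> curve t" if "0 \<le> t" "t < s" "s < 2*pi" for s t
  proof
    assume e: "curve s = curve t"
    show False
    proof (cases "s \<le> t + pi")
      case True
      then show False using height_drops[OF \<open>t < s\<close>] e by simp
    next
      case False
      then show False using height_drops[of s "t + 2*pi"] that e curve_add_2pi[of t] by simp
    qed
  qed
  then show ?thesis by (intro inj_onI) (metis atLeastLessThan_iff linorder_neqE_linordered_idom)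
qed

definition body :: "(real^2) set" where
  "body = {y. \<forall>t. y \<bullet> dir t \<le> support t}"

lemma curve_in_body: "curve s \<in> body"
  using abs_support_le abs_le_D1 by (auto simp: body_def)

lemma body_abs_le: "y \<in> body \<Longrightarrow> \<bar>y \<bullet> dir t\<bar> \<le> support t"
  unfolding body_def abs_le_iff mem_Collect_eq using dir_add_pi[of t] support_add_pi[of t] 
  by (metis inner_minus_right)

lemma closed_body: "closed body"
proof -
  have "body = (\<Inter>t. {y. y \<bullet> dir t \<le> support t})" by (auto simp: body_def)
  moreover have "closed {y. y \<bullet> dir t \<le> support t}" for t
    by (intro closed_Collect_le continuous_intros)
  ultimately show ?thesis by (simp add: closed_INT)
qed

lemma compact_body: "compact body"
proof -
  have "norm y \<le> support 0 + support (0 + pi/2)" if "y \<in> body" for y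
    using norm_le_frame[of y 0] body_abs_le[OF that, of 0] body_abs_le[OF that, of "0 + pi/2"] by linarith
  then have "bounded body" by (auto simp: bounded_iff)
  then show ?thesis using closed_body by (simp add: compact_eq_bounded_closed)
qed

lemma convex_body_body: "convex_body body"
proof -
  have "convex body"
  proof -
    have "body = (\<Inter>t. {y. y \<bullet> dir t \<le> support t})" by (auto simp: body_def)
    moreover have "convex {y. y \<bullet> dir t \<le> support t}" for t
      using convex_halfspace_le[of "dir t" "support t"] by (simp add: inner_commute)
    ultimately show ?thesis by (simp add: convex_INT)
  qed
  moreover have "ball 0 a \<subseteq> body"
  proof
    fix y :: "real^2" assume "y \<in> ball 0 a"
    then have "y \<bullet> dir t \<le> support t" for t
      using Cauchy_Schwarz_ineq2[of y "dir t"] support_ge[of t] by (simp add: dist_norm)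
    then show "y \<in> body" by (simp add: body_def)
  qed
  then have "0 \<in> interior body" using a_pos by (auto simp: mem_interior intro!: exI[of _ a])
  ultimately show ?thesis using compact_body by (auto simp: convex_body_def)
qed

lemma origin_symmetric_body: "origin_symmetric body"
proof -
  have m: "- y \<in> body" if "y \<in> body" for y
    using body_abs_le[OF that] by (auto simp: body_def abs_le_iff)
  then show ?thesis unfolding origin_symmetric_def
    by (auto intro: image_eqI[where x = "- y" for y])
qed

lemma curve_in_frontier: "curve t \<in> frontier body"
proof -
  have "curve t \<notin> interior body"
  proof
    assume "curve t \<in> interior body"
    then obtain e where e: "0 < e" "ball (curve t) e \<subseteq> body" by (auto simp: mem_interior)
    have "curve t + (e/2) *\<^sub>R dir t \<in> ball (curve t) e" using e by (simp add: dist_norm)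
    then have "(curve t + (e/2) *\<^sub>R dir t) \<bullet> dir t \<le> support t" using e by (auto simp: body_def)
    then show False using e by (simp add: support_def inner_add_left inner_dir)
  qed
  then show ?thesis using curve_in_body[of t] closed_body by (simp add: frontier_def)
qed

text \<open>To first order in \<open>s - t\<close> the support function is that of the single point \<open>curve t\<close>; this is its
  differentiability, with gradient \<open>curve t\<close>.\<close>

lemma support_expansion:
  "support s - curve t \<bullet> dir s \<le> B * (s - t)\<^sup>2"
proof -
  have *: "\<bar>integral {p..q} (\<lambda>r. w r * sin (r - s))\<bar> \<le> B * (q - p)\<^sup>2"
    if "p \<le> q" "s \<in> {p..q}" for p q
  proof -
    have "norm (integral (cbox p q) (\<lambda>r. w r * sin (r - s))) \<le> (B * (q - p)) * measure lborel (cbox p q)"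
    proof (rule has_integral_bound[OF _ integrable_integral])
      show "0 \<le> B * (q - p)" using that B_nonneg by simp
      show "(\<lambda>r. w r * sin (r - s)) integrable_on cbox p q"
        unfolding cbox_interval by (rule integrable_w_mult[where C = 1]) auto
      fix r assume r: "r \<in> cbox p q"
      have "\<bar>sin (r - s)\<bar> \<le> \<bar>r - s\<bar>" by (rule abs_sin_x_le_abs_x)
      also have "\<dots> \<le> q - p" using r that by auto
      finally show "norm (w r * sin (r - s)) \<le> B * (q - p)"
        using w_nonneg[of r] w_le[of r] B_nonneg by (simp add: abs_mult mult_mono)
    qed
    then show ?thesis using that by (simp add: power2_eq_square mult.assoc)
  qed
  show ?thesis
  proof (cases "t \<le> s")
    case True
    then show ?thesis using *[of t s] curve_diff_inner(1)[OF True, of s]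
      by (simp add: support_def inner_diff_left abs_le_iff)
  next
    case False
    then show ?thesis using *[of s t] curve_diff_inner(1)[of s t s]
      by (simp add: support_def inner_diff_left abs_le_iff power2_commute)
  qed
qed

text \<open>For a second contact point \<open>y\<close>, which can differ from \<open>curve t\<close> only by a tangential amount \<open>q\<close>, the
  support function would have to dominate \<open>q * sin (s - t)\<close> near \<open>t\<close> up to second order, for both
  signs of \<open>s - t\<close>. Hence \<open>q\<close> vanishes: the body is strictly convex.\<close>

lemma unique_contact_point:
  assumes y: "y \<in> body" and eq: "y \<bullet> dir t = support t"
  shows "y = curve t"
proof -
  define q where "q = (y - curve t) \<bullet> dir (t + pi/2)"
  have z: "(y - curve t) \<bullet> dir t = 0" using eq by (simp add: support_def inner_diff_left)
  then have dec: "y - curve t = q *\<^sub>R dir (t + pi/2)"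
    using frame_decomposition[of "y - curve t" t] by (simp add: q_def)
  have le: "q * sin (s - t) \<le> B * (s - t)\<^sup>2" for s
  proof -
    have "cos (t + pi/2 - s) = sin (s - t)" by (simp add: cos_add cos_diff sin_add sin_diff)
    then have "(y - curve t) \<bullet> dir s = q * sin (s - t)" by (simp add: dec inner_dir)
    moreover have "(y - curve t) \<bullet> dir s \<le> support s - curve t \<bullet> dir s"
      using y by (simp add: body_def inner_diff_left)
    ultimately show ?thesis using support_expansion[of s t] by linarith
  qed
  have "((\<lambda>s. B * (s - t)\<^sup>2 - q * sin (s - t)) has_real_derivative - q) (at t)"
    by (auto intro!: derivative_eq_intros)
  then have "- q = 0"
    by (rule DERIV_local_min[where d = 1]) (use le in auto)
  then show ?thesis using dec by simp
qed

lemma inverse_gauss_image_body: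
  assumes "\<eta> \<subseteq> sphere 0 1"
  shows "inverse_gauss_image body \<eta> = curve ` {t \<in> {0..<2*pi}. dir t \<in> \<eta>}"
proof (intro equalityI subsetI)
  fix x assume "x \<in> inverse_gauss_image body \<eta>"
  then obtain v where x: "x \<in> frontier body" and v: "v \<in> \<eta>" "outer_unit_normal body x v"
    by (auto simp: inverse_gauss_image_def)
  then have "norm v = 1" by (simp add: outer_unit_normal_def)
  then obtain t where t: "t \<in> {0..<2*pi}" "v = dir t" using ex_angle by blast
  have xb: "x \<in> body" using x closed_body by (simp add: frontier_def)
  have "(curve t - x) \<bullet> dir t \<le> 0" using v t curve_in_body by (auto simp: outer_unit_normal_def)
  then have "x \<bullet> dir t = support t" using xb by (auto simp: body_def support_def inner_diff_left intro: antisym)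
  then have "x = curve t" by (rule unique_contact_point[OF xb])
  then show "x \<in> curve ` {t \<in> {0..<2*pi}. dir t \<in> \<eta>}" using t v by auto
next
  fix x assume "x \<in> curve ` {t \<in> {0..<2*pi}. dir t \<in> \<eta>}"
  then obtain t where t: "dir t \<in> \<eta>" "x = curve t" by auto
  have "outer_unit_normal body (curve t) (dir t)"
    by (auto simp: outer_unit_normal_def body_def support_def inner_diff_left)
  then show "x \<in> inverse_gauss_image body \<eta>"
    using t curve_in_frontier by (auto simp: inverse_gauss_image_def)
qed

section \<open>Hausdorff measure of arcs\<close>

lemma dist_curve_le: "s \<le> t \<Longrightarrow> dist (curve t) (curve s) \<le> integral {s..t} w"
  unfolding dist_norm curve_diff
  by (rule integral_norm_bound_integral[OF integrable_w_dir integrable_w]) (simp add: w_nonneg)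

lemma integral_w_combine: "p \<le> q \<Longrightarrow> q \<le> r \<Longrightarrow> integral {p..q} w + integral {q..r} w = integral {p..r} w"
  by (rule Henstock_Kurzweil_Integration.integral_combine) (auto simp: integrable_w)

lemma integral_w_bounds: "s \<le> t \<Longrightarrow> 0 \<le> integral {s..t} w \<and> integral {s..t} w \<le> B * (t - s)"
proof
  assume st: "s \<le> t"
  show "0 \<le> integral {s..t} w" by (rule Henstock_Kurzweil_Integration.integral_nonneg[OF integrable_w]) (rule w_nonneg)
  show "integral {s..t} w \<le> B * (t - s)"
    using integral_le[OF integrable_w integrable_const_ivl, of s t B] w_le st by (simp add: mult.commute)
qed

text \<open>Cover by images of small parameter intervals: the diameter of each is at most the integral of \<open>w\<close> over
  it.\<close>

lemma hausdorff1_arc_le: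
  assumes st: "s \<le> t"
  shows "hausdorff1_outer (curve ` {s..t}) \<le> ennreal (integral {s..t} w)"
  unfolding hausdorff1_outer_def
proof (rule SUP_least)
  fix \<delta> :: real assume "\<delta> \<in> {0<..}"
  then have \<delta>: "0 < \<delta>" by simp
  obtain n where n: "B * (t - s) / \<delta> < real n" using reals_Archimedean2 by blast
  have "0 \<le> B * (t - s) / \<delta>" using st \<delta> B_nonneg by simp
  then have n0: "0 < n" using n by (metis less_le_trans not_gr_zero of_nat_0 not_less)
  (* Equidistant points, so fine that w has integral at most \<delta> over every piece. *)
  define p where "p i = s + real i * ((t - s) / real n)" for i
  have p_mono: "p i \<le> p (Suc i)" for i using st n0 unfolding p_def by (intro add_left_mono mult_right_mono) auto
  have p_s: "s \<le> p i" for i using st n0 by (simp add: p_def)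
  have p0: "p 0 = s" and pn: "p n = t" using n0 by (auto simp: p_def)
  have p_le: "p i \<le> t" if "i \<le> n" for i
    using lift_Suc_mono_le[of p i n] p_mono pn that by auto
  define U where "U i = (if i < n then curve ` {p i..p (Suc i)} else {})" for i
  have diam: "diameter (curve ` {p i..p (Suc i)}) \<le> integral {p i..p (Suc i)} w" for i
  proof (rule diameter_le)
    show "curve ` {p i..p (Suc i)} \<noteq> {} \<or> 0 \<le> integral {p i..p (Suc i)} w" using p_mono by simp
    have *: "norm (curve y - curve x) \<le> integral {p i..p (Suc i)} w" if "p i \<le> x" "x \<le> y" "y \<le> p (Suc i)" for x y
    proof -
      have "integral {x..y} w \<le> integral {p i..p (Suc i)} w"
        by (rule integral_subset_le) (use that integrable_w w_nonneg in auto)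
      then show ?thesis using dist_curve_le[OF \<open>x \<le> y\<close>] by (simp add: dist_norm)
    qed
    fix x y assume "x \<in> curve ` {p i..p (Suc i)}" "y \<in> curve ` {p i..p (Suc i)}"
    then obtain x' y' where "x = curve x'" "y = curve y'" "x' \<in> {p i..p (Suc i)}" "y' \<in> {p i..p (Suc i)}" by auto
    then show "norm (x - y) \<le> integral {p i..p (Suc i)} w"
      using *[of x' y'] *[of y' x'] by (cases "x' \<le> y'") (auto simp: norm_minus_commute)
  qed
  have bdd: "bounded (curve ` {p i..p (Suc i)})" for i
    by (intro compact_imp_bounded compact_continuous_image continuous_curve) simp
  have small: "integral {p i..p (Suc i)} w \<le> \<delta>" for i
  proof -
    have "integral {p i..p (Suc i)} w \<le> B * (p (Suc i) - p i)" using integral_w_bounds[OF p_mono] by simp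
    also have "p (Suc i) - p i = (t - s) / real n" by (simp add: p_def distrib_right add_divide_distrib)
    also have "B * ((t - s) / real n) = B * (t - s) / real n" by simp
    also have "\<dots> \<le> \<delta>" using n n0 \<delta> by (simp add: field_simps)
    finally show ?thesis .
  qed
  have cover: "curve ` {s..t} \<subseteq> (\<Union>i. U i)"
  proof
    fix y assume "y \<in> curve ` {s..t}"
    then obtain x where x: "y = curve x" "s \<le> x" "x \<le> t" by auto
    have "\<exists>i<n. x \<in> {p i..p (Suc i)}"
    proof -
      define i where "i = (LEAST i. x \<le> p i)"
      have ex: "x \<le> p n" using x pn by simp
      have xi: "x \<le> p i" unfolding i_def using ex by (rule LeastI)
      have iN: "i \<le> n" unfolding i_def using ex by (rule Least_le)
      show ?thesis
      proof (cases i)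
        case 0
        then have "x = p 0" using xi x p0 by simp
        then show ?thesis using n0 p_mono[of 0] by (intro exI[of _ 0]) simp
      next
        case (Suc j)
        then have "\<not> x \<le> p j" using not_less_Least[of j "\<lambda>i. x \<le> p i"] unfolding i_def by simp
        then show ?thesis using Suc xi iN by (intro exI[of _ j]) simp
      qed
    qed
    then obtain i where "i < n" "x \<in> {p i..p (Suc i)}" by blast
    then have "y \<in> U i" using x(1) unfolding U_def by simp
    then show "y \<in> (\<Union>i. U i)" by blast
  qed
  have "hausdorff1_content \<delta> (curve ` {s..t}) \<le> (\<Sum>i. ennreal (diameter (U i)))"
    by (rule hausdorff1_content_le[OF cover])
       (use bdd diam small \<delta> in \<open>auto simp: U_def intro: order_trans\<close>)
  also have "\<dots> = (\<Sum>i<n. ennreal (diameter (U i)))" by (rule suminf_finite) (auto simp: U_def)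
  also have "\<dots> \<le> (\<Sum>i<n. ennreal (integral {p i..p (Suc i)} w))"
    by (rule sum_mono) (simp add: U_def ennreal_leI diam)
  also have "\<dots> = ennreal (\<Sum>i<n. integral {p i..p (Suc i)} w)"
    using integral_w_bounds[OF p_mono] by (intro sum_ennreal) simp
  also have "(\<Sum>i<n. integral {p i..p (Suc i)} w) = (\<Sum>i<n. integral {s..p (Suc i)} w - integral {s..p i} w)"
  proof (rule sum.cong[OF refl])
    fix i
    show "integral {p i..p (Suc i)} w = integral {s..p (Suc i)} w - integral {s..p i} w"
      using integral_w_combine[OF p_s[of i] p_mono[of i]] by linarith
  qed
  also have "\<dots> = integral {s..t} w"
    using sum_lessThan_telescope[of "\<lambda>i. integral {s..p i} w" n] p0 pn by simp
  finally show "hausdorff1_content \<delta> (curve ` {s..t}) \<le> ennreal (integral {s..t} w)" .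
qed

text \<open>Project onto the tangent direction at the starting point; the velocity turns by at most \<open>t - s\<close>.\<close>

lemma hausdorff1_arc_ge:
  assumes st: "s \<le> t" "t \<le> s + pi/2"
  shows "ennreal (cos (t - s) * integral {s..t} w) \<le> hausdorff1_outer (curve ` {s..t})"
proof -
  let ?p = "\<lambda>y. y \<bullet> dir (s + pi/2)"
  have ic: "(\<lambda>r. w r * cos (r - s)) integrable_on {s..t}" by (rule integrable_w_mult[where C = 1]) auto
  have "cos (t - s) * integral {s..t} w = integral {s..t} (\<lambda>r. w r * cos (t - s))" by (simp add: mult.commute)
  also have "\<dots> \<le> integral {s..t} (\<lambda>r. w r * cos (r - s))"
  proof (rule integral_le[OF integrable_on_mult_left[OF integrable_w] ic])
    fix r assume r: "r \<in> {s..t}"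
    have "t - s \<le> pi" using st pi_gt_zero by linarith
    then show "w r * cos (t - s) \<le> w r * cos (r - s)"
      using r st by (intro mult_left_mono w_nonneg cos_monotone_0_pi_le) auto
  qed
  also have "\<dots> = ?p (curve t) - ?p (curve s)" using curve_diff_inner(2)[OF st(1), of s] by (simp add: inner_diff_left)
  finally have "ennreal (cos (t - s) * integral {s..t} w) \<le> ennreal (?p (curve t) - ?p (curve s))" by (rule ennreal_leI)
  also have "\<dots> \<le> hausdorff1_outer (curve ` {s..t})"
  proof (rule hausdorff1_outer_ge_projection)
    show "\<bar>?p x - ?p y\<bar> \<le> dist x y" for x y
      using Cauchy_Schwarz_ineq2[of "x - y" "dir (s + pi/2)"] by (simp add: dist_norm inner_diff_left)
    have conn: "connected (?p ` curve ` {s..t})"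
      by (intro connected_continuous_image continuous_intros continuous_curve) simp
    show "{?p (curve s)..?p (curve t)} \<subseteq> ?p ` curve ` {s..t}"
      by (rule connected_contains_Icc[OF conn]) (use st in auto)
  qed
  finally show ?thesis .
qed

text \<open>The inverse of the parametrisation; meaningful on \<open>boundary_curve\<close> only.\<close>

definition angle_of :: "real^2 \<Rightarrow> real" where
  "angle_of = the_inv_into {0..<2*pi} curve"

definition boundary_curve :: "(real^2) set" where "boundary_curve = curve ` {0..<2*pi}"

lemma angle_of_curve [simp]: "0 \<le> t \<Longrightarrow> t < 2*pi \<Longrightarrow> angle_of (curve t) = t"
  unfolding angle_of_def by (rule the_inv_into_f_f[OF inj_on_curve]) simp

lemma arc_null: "hausdorff1_outer {curve t} = 0"
  using hausdorff1_arc_le[of t t] by simp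

lemma arc_borel: "curve ` {s..t} \<in> sets borel"
  by (intro borel_compact compact_continuous_image continuous_curve) simp

lemma half_open_arc:
  assumes "s \<le> t"
  shows "curve ` {s..<t} \<in> sets borel" "emeasure hausdorff1 (curve ` {s..<t}) = emeasure hausdorff1 (curve ` {s..t})"
proof -
  have b: "curve ` {s..<t} = curve ` {s..t} \<or> curve ` {s..<t} = curve ` {s..t} - {curve t}"
  proof -
    have "{s..t} = insert t {s..<t}" using assms by auto
    then have "curve ` {s..t} = insert (curve t) (curve ` {s..<t})" by simp
    then show ?thesis by (cases "curve t \<in> curve ` {s..<t}") auto
  qed
  then show 1: "curve ` {s..<t} \<in> sets borel" using arc_borel[of s t] by auto
  have "hausdorff1_outer (curve ` {s..t}) \<le> hausdorff1_outer (curve ` {s..<t} \<union> {curve t})"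
    by (rule hausdorff1_outer_mono) (auto simp: image_iff less_le)
  also have "\<dots> \<le> hausdorff1_outer (curve ` {s..<t})"
    using hausdorff1_outer_subadditive[of "curve ` {s..<t}" "{curve t}"] by (simp add: arc_null)
  finally show "emeasure hausdorff1 (curve ` {s..<t}) = emeasure hausdorff1 (curve ` {s..t})"
    using 1 arc_borel by (simp add: emeasure_hausdorff1 antisym hausdorff1_outer_mono image_mono atLeastLessThan_subseteq_atLeastAtMost_iff)
qed

lemma boundary_curve_borel [measurable]: "boundary_curve \<in> sets borel"
  unfolding boundary_curve_def by (rule half_open_arc) simp

text \<open>The two estimates for an arc differ by the factor \<open>cos (t - s)\<close>, an error of second order at most
  since the integral itself is of first order. So the Hausdorff measure of a growing arc and the
  integral of \<open>w\<close> have a constant difference.\<close>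

lemma emeasure_arc:
  assumes t: "0 \<le> t" "t \<le> 2*pi"
  shows "emeasure hausdorff1 (curve ` {0..<t}) = ennreal (integral {0..t} w)"
proof -
  have fin: "emeasure hausdorff1 (curve ` {s..<t}) \<le> ennreal (integral {s..t} w)" if "s \<le> t" for s t
    using half_open_arc[OF that] hausdorff1_arc_le[OF that] arc_borel[of s t] by (simp add: emeasure_hausdorff1)
  define G where "G t = measure hausdorff1 (curve ` {0..<t})" for t
  have eq: "emeasure hausdorff1 (curve ` {s..<t}) = ennreal (measure hausdorff1 (curve ` {s..<t}))" if "s \<le> t" for s t
    using fin[OF that] by (intro emeasure_eq_ennreal_measure) (auto simp: top_unique)
  define D where "D t = integral {0..t} w - G t" for t
  have "\<bar>D t' - D s\<bar> \<le> B * (t' - s)\<^sup>2" if st: "0 \<le> s" "s \<le> t'" "t' \<le> t" for s t'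
  proof -
    let ?m = "measure hausdorff1 (curve ` {s..<t'})" and ?I = "integral {s..t'} w"
    have "curve ` {0..<t'} = curve ` {0..<s} \<union> curve ` {s..<t'}"
      using st by (simp flip: image_Un add: ivl_disj_un)
    moreover have "curve ` {0..<s} \<inter> curve ` {s..<t'} = {}"
      using inj_on_image_Int[OF inj_on_curve, of "{0..<s}" "{s..<t'}"] st t by auto
    ultimately have "emeasure hausdorff1 (curve ` {0..<t'}) = emeasure hausdorff1 (curve ` {0..<s}) + emeasure hausdorff1 (curve ` {s..<t'})"
      using plus_emeasure[of "curve ` {0..<s}" hausdorff1 "curve ` {s..<t'}"] half_open_arc(1) st by auto
    then have "ennreal (G t') = ennreal (G s) + ennreal ?m"
      unfolding G_def by (simp only: eq[OF st(1)] eq[OF st(2)] eq[OF order_trans[OF st(1,2)]])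
    then have G: "G t' = G s + ?m"
      by (simp add: G_def measure_nonneg flip: ennreal_plus)
    have I: "0 \<le> ?I" "?I \<le> B * (t' - s)" using integral_w_bounds[OF st(2)] by auto
    have up: "?m \<le> ?I" using fin[OF st(2)] eq[OF st(2)] I by (simp add: ennreal_le_iff)
    have low: "?I - ?m \<le> B * (t' - s)\<^sup>2"
    (* Past a quarter turn the quadratic bound is trivial. *)
    proof (cases "t' \<le> s + pi/2")
      case True
      have "ennreal (cos (t' - s) * ?I) \<le> ennreal ?m"
        using hausdorff1_arc_ge[OF st(2) True] half_open_arc[OF st(2)] arc_borel[of s t'] eq[OF st(2)]
        by (simp add: emeasure_hausdorff1)
      then have "cos (t' - s) * ?I \<le> ?m" by (simp add: ennreal_le_iff)
      moreover have "1 - cos r \<le> r" if "0 \<le> r" for r :: real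
      proof -
        have "(\<lambda>r. r + cos r) 0 \<le> (\<lambda>r. r + cos r) r"
        proof (rule DERIV_nonneg_imp_nondecreasing[OF that])
          fix x :: real
          have "((\<lambda>r. r + cos r) has_real_derivative 1 - sin x) (at x)" by (auto intro!: derivative_eq_intros)
          then show "\<exists>y. ((\<lambda>r. r + cos r) has_real_derivative y) (at x) \<and> 0 \<le> y" by (auto intro!: exI[of _ "1 - sin x"])
        qed
        then show ?thesis by simp
      qed
      from this[of "t' - s"] have "(1 - cos (t' - s)) * ?I \<le> (t' - s) * (B * (t' - s))"
        using I st by (intro mult_mono) auto
      ultimately show ?thesis by (simp add: algebra_simps power2_eq_square)
    next
      case False
      then have "1 \<le> t' - s" using pi_ge_two by linarith
      then have "B * (t' - s) * 1 \<le> B * (t' - s) * (t' - s)" using B_nonneg by (intro mult_left_mono) auto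
      then have "B * (t' - s) \<le> B * (t' - s)\<^sup>2" by (simp add: power2_eq_square mult.assoc)
      then show ?thesis using I measure_nonneg[of hausdorff1 "curve ` {s..<t'}"] by linarith
    qed
    have "D t' - D s = ?I - ?m"
      using G integral_w_combine[OF st(1,2)] by (simp add: D_def)
    then show ?thesis using up low by simp
  qed
  then have "D t = D 0" by (rule constant_if_quadratic_increments[OF t(1)])
  then show ?thesis using eq[OF t(1)] by (simp add: D_def G_def)
qed

lemma angle_of_measurable [measurable]: "angle_of \<in> borel_measurable (restrict_space hausdorff1 boundary_curve)"
proof (rule borel_measurableI_less)
  fix c :: real
  have "{y \<in> boundary_curve. angle_of y < c} = curve ` {0..<min c (2*pi)}"
    by (auto simp: boundary_curve_def)
  moreover have "curve ` {0..<min c (2*pi)} \<in> sets borel"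
    by (cases "0 \<le> min c (2*pi)") (auto intro: half_open_arc)
  ultimately show "{y \<in> space (restrict_space hausdorff1 boundary_curve). angle_of y < c} \<in> sets (restrict_space hausdorff1 boundary_curve)"
    by (auto simp: space_restrict_space sets_restrict_space_iff)
qed

text \<open>Pulled back to the normal angle, Hausdorff measure on the curve has density \<open>w\<close>: both measures agree
  on initial segments, which generate the Borel sets.\<close>

lemma distr_angle_of:
  "distr (restrict_space hausdorff1 boundary_curve) borel angle_of = density lborel (\<lambda>t. ennreal (w t) * indicator {0..<2*pi} t)"
    (is "?N = ?M")
proof (rule measure_eqI_generator_eq[where E = "range lessThan" and \<Omega> = UNIV and A = "\<lambda>i. {..<real i}"])
  show "Int_stable (range (lessThan :: real \<Rightarrow> real set))"
  proof -
    have "{..<x} \<inter> {..<y} = {..<min x y}" for x y :: real by auto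
    then show ?thesis unfolding Int_stable_def by blast
  qed
  have s: "sets borel = sigma_sets UNIV (range (lessThan :: real \<Rightarrow> real set))"
    by (simp add: borel_Iio)
  show "sets ?N = sigma_sets UNIV (range lessThan)" "sets ?M = sigma_sets UNIV (range lessThan)"
    using s by auto
  have key: "emeasure ?N {..<c} = emeasure ?M {..<c} \<and> emeasure ?N {..<c} < top" for c
  proof -
    define d where "d = max 0 (min c (2*pi))"
    have d: "0 \<le> d" "d \<le> 2*pi" by (auto simp: d_def)
    have set: "angle_of -` {..<c} \<inter> boundary_curve = curve ` {0..<d}"
      by (auto simp: boundary_curve_def d_def)
    have "emeasure ?N {..<c} = emeasure hausdorff1 (curve ` {0..<d})"
    proof -
      have "emeasure ?N {..<c} = emeasure (restrict_space hausdorff1 boundary_curve) (curve ` {0..<d})"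
        by (subst emeasure_distr[OF angle_of_measurable]) (simp_all add: space_restrict_space set)
      also have "\<dots> = emeasure hausdorff1 (curve ` {0..<d})"
        by (rule emeasure_restrict_space) (use d in \<open>auto simp: boundary_curve_def[symmetric]\<close>, auto simp: boundary_curve_def)
      finally show ?thesis .
    qed
    also have "\<dots> = ennreal (integral {0..d} w)" by (rule emeasure_arc[OF d])
    also have "\<dots> = (\<integral>\<^sup>+t. ennreal (w t) * indicator {0..d} t \<partial>lborel)"
      by (rule nn_integral_bounded_Icc[OF w_borel w_nonneg w_le, symmetric])
    also have "\<dots> = (\<integral>\<^sup>+t. ennreal (w t) * indicator {0..<2*pi} t * indicator {..<c} t \<partial>lborel)"
    proof (rule nn_integral_cong_AE)
      show "AE t in lborel. ennreal (w t) * indicator {0..d} t = ennreal (w t) * indicator {0..<2*pi} t * indicator {..<c} t"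
        using AE_lborel_singleton[of d] AE_lborel_singleton[of 0] by eventually_elim (auto simp: indicator_def d_def)
    qed
    also have "\<dots> = emeasure ?M {..<c}" by (subst emeasure_density) auto
    finally have *: "emeasure ?N {..<c} = emeasure ?M {..<c}" "emeasure ?N {..<c} = ennreal (integral {0..d} w)"
      using emeasure_arc[OF d] \<open>emeasure ?N {..<c} = emeasure hausdorff1 (curve ` {0..<d})\<close> by auto
    from *(2) have "emeasure ?N {..<c} < top" by (simp only: ennreal_less_top)
    with *(1) show ?thesis by blast
  qed
  show "emeasure ?N X = emeasure ?M X" if "X \<in> range lessThan" for X using that key by auto
  show "emeasure ?N {..<real i} \<noteq> \<infinity>" for i
    using conjunct2[OF key[of "real i"]] by (simp only: infinity_ennreal_def less_top)
  show "(\<Union>i. {..<real i}) = UNIV" using reals_Archimedean2 by auto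
qed auto

text \<open>The inverse Gauss image of \<open>\<eta>\<close> consists of the points whose normal angle has its direction in \<open>\<eta>\<close>,
  so this is a change of variables.\<close>

lemma nn_integral_inverse_gauss_image:
  assumes \<eta>: "\<eta> \<in> sets borel" "\<eta> \<subseteq> sphere 0 1" and e [measurable]: "e \<in> borel_measurable borel"
  shows "(\<integral>\<^sup>+x\<in>inverse_gauss_image body \<eta>. e x \<partial>hausdorff1)
    = (\<integral>\<^sup>+t. e (curve t) * ennreal (w t) * indicator \<eta> (dir t) * indicator {0..<2*pi} t \<partial>lborel)"
proof -
  note [measurable] = \<eta>(1)
  let ?\<phi> = "\<lambda>t. e (curve t) * indicator \<eta> (dir t)"
  have "(\<lambda>t. indicator \<eta> (dir t) :: ennreal) \<in> borel_measurable borel"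
    by (rule measurable_compose[OF borel_measurable_dir borel_measurable_indicator[OF \<eta>(1)]])
  then have phi: "?\<phi> \<in> borel_measurable borel"
    by (intro borel_measurable_times_ennreal measurable_compose[OF curve_borel e])
  have "(\<integral>\<^sup>+x\<in>inverse_gauss_image body \<eta>. e x \<partial>hausdorff1) = (\<integral>\<^sup>+x. ?\<phi> (angle_of x) * indicator boundary_curve x \<partial>hausdorff1)"
  proof (rule nn_integral_cong)
    fix x
    show "e x * indicator (inverse_gauss_image body \<eta>) x = ?\<phi> (angle_of x) * indicator boundary_curve x"
    proof (cases "x \<in> boundary_curve")
      case True
      then obtain t where "x = curve t" "0 \<le> t" "t < 2*pi" by (auto simp: boundary_curve_def)
      moreover have "curve t \<in> inverse_gauss_image body \<eta> \<longleftrightarrow> dir t \<in> \<eta>" if "0 \<le> t" "t < 2*pi" for t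
      proof
        assume "curve t \<in> inverse_gauss_image body \<eta>"
        then obtain t' where "t' \<in> {0..<2*pi}" "dir t' \<in> \<eta>" "curve t = curve t'"
          unfolding inverse_gauss_image_body[OF \<eta>(2)] by auto
        then show "dir t \<in> \<eta>" using inj_onD[OF inj_on_curve, of t t'] that by simp
      next
        assume "dir t \<in> \<eta>"
        then show "curve t \<in> inverse_gauss_image body \<eta>"
          unfolding inverse_gauss_image_body[OF \<eta>(2)] using that by auto
      qed
      ultimately show ?thesis using True by (auto simp: indicator_def)
    next
      case False
      then have "x \<notin> inverse_gauss_image body \<eta>" unfolding inverse_gauss_image_body[OF \<eta>(2)] boundary_curve_def by auto
      then show ?thesis using False by simp
    qed
  qed
  also have "\<dots> = (\<integral>\<^sup>+x. ?\<phi> (angle_of x) \<partial>restrict_space hausdorff1 boundary_curve)"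
    by (rule nn_integral_restrict_space[symmetric]) simp
  also have "\<dots> = (\<integral>\<^sup>+t. ?\<phi> t \<partial>distr (restrict_space hausdorff1 boundary_curve) borel angle_of)"
    by (rule nn_integral_distr[OF angle_of_measurable, symmetric]) (simp only: measurable_distr_eq1 phi)
  also have "\<dots> = (\<integral>\<^sup>+t. (ennreal (w t) * indicator {0..<2*pi} t) * ?\<phi> t \<partial>lborel)"
    unfolding distr_angle_of
  proof (rule nn_integral_density)
    show "(\<lambda>t. ennreal (w t) * indicator {0..<2*pi} t) \<in> borel_measurable lborel" by measurable
    show "?\<phi> \<in> borel_measurable lborel" by (subst measurable_cong_sets[OF sets_lborel refl]) (rule phi)
  qed
  also have "\<dots> = (\<integral>\<^sup>+t. e (curve t) * ennreal (w t) * indicator \<eta> (dir t) * indicator {0..<2*pi} t \<partial>lborel)"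
    by (simp add: mult_ac)
  finally show ?thesis .
qed

end

section \<open>The Gaussian surface area measure\<close>

lemma arc_length_eq:
  "arc_length = distr (restrict_space lborel {0..<2*pi}) (restrict_space borel (sphere 0 1)) dir"
  by (simp add: arc_length_def dir_def [abs_def])

lemma measurable_dir_sphere [measurable]:
  "dir \<in> measurable (restrict_space lborel {0..<2*pi}) (restrict_space borel (sphere 0 1))"
  by (intro measurable_restrict_space2 measurable_restrict_space1) auto

lemma space_arc_length [simp]: "space arc_length = sphere 0 1"
  by (simp add: arc_length_eq space_restrict_space)

lemma sets_arc_length [simp]: "sets arc_length = sets (restrict_space borel (sphere 0 1))"
  by (simp add: arc_length_eq)

lemma nn_integral_arc_length:
  assumes "f \<in> borel_measurable borel"
  shows "(\<integral>\<^sup>+v. f v \<partial>arc_length) = (\<integral>\<^sup>+t. f (dir t) * indicator {0..<2*pi} t \<partial>lborel)"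
proof -
  have fS: "f \<in> borel_measurable (restrict_space borel (sphere 0 1))"
    using assms by (rule measurable_restrict_space1)
  have "(\<integral>\<^sup>+v. f v \<partial>arc_length) = (\<integral>\<^sup>+t. f (dir t) \<partial>restrict_space lborel {0..<2*pi})"
    unfolding arc_length_eq
    by (rule nn_integral_distr[OF measurable_dir_sphere]) (simp only: measurable_distr_eq1 fS)
  then show ?thesis by (simp add: nn_integral_restrict_space)
qed

lemma integral_arc_length:
  fixes f :: "real^2 \<Rightarrow> real"
  assumes f [measurable]: "f \<in> borel_measurable borel" and bd: "\<And>v. \<bar>f v\<bar> \<le> C"
  shows "(\<integral>v. f v \<partial>arc_length) = integral {0..2*pi} (\<lambda>t. f (dir t))"
proof -
  have fu [measurable]: "(\<lambda>t. f (dir t)) \<in> borel_measurable borel" by (rule measurable_compose[OF borel_measurable_dir f])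
  have "f \<in> borel_measurable (restrict_space borel (sphere 0 1))"
    using f by (rule measurable_restrict_space1)
  then have "(\<integral>v. f v \<partial>arc_length) = (\<integral>t. f (dir t) \<partial>restrict_space lborel {0..<2*pi})"
    unfolding arc_length_eq by (intro integral_distr measurable_dir_sphere)
  also have "\<dots> = (\<integral>t. indicator {0..<2*pi} t *\<^sub>R f (dir t) \<partial>lborel)"
    by (rule integral_restrict_space) simp
  also have "\<dots> = (\<integral>t. indicator {0..2*pi} t *\<^sub>R f (dir t) \<partial>lborel)"
  proof (rule integral_cong_AE)
    show "AE t in lborel. indicat_real {0..<2*pi} t *\<^sub>R f (dir t) = indicator {0..2*pi} t *\<^sub>R f (dir t)"
      using AE_lborel_singleton[of "2*pi"] by eventually_elim (auto simp: indicator_def)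
  qed measurable
  also have "\<dots> = integral {0..2*pi} (\<lambda>t. f (dir t))"
    using set_borel_integral_eq_integral(2)[OF bounded_borel_integrable(2)[OF fu, of C 0 "2*pi"]] bd
    by (simp add: set_lebesgue_integral_def)
  finally show ?thesis .
qed

text \<open>The set function that defines the measure agrees on Borel sets with a measure, and therefore defines
  that measure.\<close>

lemma (in convex_curve) gauss_surface_area_measure_body:
  assumes f [measurable]: "f \<in> borel_measurable borel" and f0: "\<And>v. 0 \<le> f v"
    and w_eq: "\<And>t. w t = 2 * pi * f (dir t) * exp ((norm (curve t))\<^sup>2 / 2)"
  shows "gauss_surface_area_measure body = density arc_length (\<lambda>v. ennreal (f v))"
proof -
  let ?S = "sphere 0 1 :: (real^2) set" and ?D = "density arc_length (\<lambda>v. ennreal (f v))"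
  let ?\<mu> = "\<lambda>\<eta>. ennreal (1 / (2 * pi)) * (\<integral>\<^sup>+ x \<in> inverse_gauss_image body \<eta>. ennreal (exp (- (norm x)\<^sup>2 / 2)) \<partial>hausdorff1)"
  have fm: "(\<lambda>v. ennreal (f v)) \<in> borel_measurable arc_length"
    by (subst measurable_cong_sets[OF sets_arc_length refl], rule measurable_restrict_space1) measurable
  have val: "?\<mu> \<eta> = emeasure ?D \<eta>" if \<eta>: "\<eta> \<in> sets (restrict_space borel ?S)" for \<eta>
  proof -
    have \<eta>b [measurable]: "\<eta> \<in> sets borel" and \<eta>S: "\<eta> \<subseteq> ?S" using \<eta> by (auto simp: sets_restrict_space_iff)
    have iu: "(\<lambda>t. indicator \<eta> (dir t) :: ennreal) \<in> borel_measurable borel"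
      by (rule measurable_compose[OF borel_measurable_dir borel_measurable_indicator[OF \<eta>b]])
    have fu: "(\<lambda>t. ennreal (f (dir t))) \<in> borel_measurable borel"
      by (rule measurable_compose[OF borel_measurable_dir]) measurable
    have "?\<mu> \<eta> = ennreal (1 / (2*pi)) * (\<integral>\<^sup>+t. ennreal (exp (- (norm (curve t))\<^sup>2 / 2)) * ennreal (w t) * indicator \<eta> (dir t) * indicator {0..<2*pi} t \<partial>lborel)"
      by (subst nn_integral_inverse_gauss_image[OF \<eta>b \<eta>S]) auto
    also have "(\<lambda>t. ennreal (exp (- (norm (curve t))\<^sup>2 / 2)) * ennreal (w t)) = (\<lambda>t. ennreal (2*pi) * ennreal (f (dir t)))"
    proof
      fix t
      have one: "exp (- (norm (curve t))\<^sup>2 / 2) * exp ((norm (curve t))\<^sup>2 / 2) = 1"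
        by (simp flip: exp_add)
      have "exp (- (norm (curve t))\<^sup>2 / 2) * w t = (2 * pi * f (dir t)) * (exp (- (norm (curve t))\<^sup>2 / 2) * exp ((norm (curve t))\<^sup>2 / 2))"
        by (simp only: w_eq[of t] mult_ac)
      then have eq: "exp (- (norm (curve t))\<^sup>2 / 2) * w t = 2 * pi * f (dir t)"
        by (simp only: one mult_1_right)
      have "ennreal (exp (- (norm (curve t))\<^sup>2 / 2)) * ennreal (w t) = ennreal (exp (- (norm (curve t))\<^sup>2 / 2) * w t)"
        by (rule ennreal_mult[OF exp_ge_zero w_nonneg, symmetric])
      also have "\<dots> = ennreal (2*pi) * ennreal (f (dir t))"
        unfolding eq by (rule ennreal_mult) (simp_all add: f0)
      finally show "ennreal (exp (- (norm (curve t))\<^sup>2 / 2)) * ennreal (w t) = ennreal (2*pi) * ennreal (f (dir t))" .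
    qed
    also have "ennreal (1 / (2*pi)) * (\<integral>\<^sup>+t. ennreal (2*pi) * ennreal (f (dir t)) * indicator \<eta> (dir t) * indicator {0..<2*pi} t \<partial>lborel)
       = ennreal (1 / (2*pi)) * (ennreal (2*pi) * (\<integral>\<^sup>+t. ennreal (f (dir t)) * indicator \<eta> (dir t) * indicator {0..<2*pi} t \<partial>lborel))"
      unfolding mult.assoc
    proof (subst nn_integral_cmult)
      show "(\<lambda>t. ennreal (f (dir t)) * (indicator \<eta> (dir t) * indicator {0..<2*pi} t)) \<in> borel_measurable lborel"
        unfolding measurable_cong_sets[OF sets_lborel refl]
        by (intro borel_measurable_times_ennreal fu iu borel_measurable_indicator) simp
    qed (rule refl)
    also have "\<dots> = (\<integral>\<^sup>+t. ennreal (f (dir t)) * indicator \<eta> (dir t) * indicator {0..<2*pi} t \<partial>lborel)"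
    proof -
      have "ennreal (1 / (2*pi)) * ennreal (2*pi) = 1"
        using ennreal_mult[of "1 / (2*pi)" "2*pi"] by simp
      then show ?thesis by (simp only: mult.assoc[symmetric] mult_1_left)
    qed
    also have "\<dots> = (\<integral>\<^sup>+v. ennreal (f v) * indicator \<eta> v \<partial>arc_length)"
      by (rule nn_integral_arc_length[symmetric])
        (intro borel_measurable_times_ennreal borel_measurable_indicator \<eta>b measurable_compose[OF f measurable_ennreal])
    also have "\<dots> = emeasure ?D \<eta>"
      using \<eta> by (intro emeasure_density[OF fm, symmetric]) simp
    finally show ?thesis .
  qed
  have ss: "sigma_sets ?S (sets (restrict_space borel ?S)) = sets (restrict_space borel ?S)"
    using sets.sigma_sets_eq[of "restrict_space borel ?S"] by (simp add: space_restrict_space)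
  have "gauss_surface_area_measure body = measure_of ?S (sets (restrict_space borel ?S)) (emeasure ?D)"
    unfolding gauss_surface_area_measure_def
  proof (rule measure_of_eq)
    show "sets (restrict_space borel ?S) \<subseteq> Pow ?S"
      using sets.space_closed[of "restrict_space borel ?S"] by (simp add: space_restrict_space)
  qed (use val in \<open>simp add: ss\<close>)
  also have "\<dots> = ?D"
    using measure_of_of_measure[of ?D] by simp
  finally show ?thesis .
qed

theorem theorem1p3:
  fixes f :: "real^2 \<Rightarrow> real"
  assumes "integrable arc_length f"
    and "\<forall>v \<in> sphere 0 1. f (- v) = f v"
    and "(\<integral>v. \<bar>f v\<bar> \<partial>arc_length) < 1 / sqrt (2 * pi)"
    and "\<exists>\<tau>>0. AE v in arc_length. 1 / \<tau> < f v \<and> f v < \<tau>"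
  shows "\<exists>K1 K2. K1 \<noteq> K2 \<and>
    convex_body K1 \<and> origin_symmetric K1 \<and>
    convex_body K2 \<and> origin_symmetric K2 \<and>
    gauss_surface_area_measure K1 = density arc_length (\<lambda>v. ennreal (f v)) \<and>
    gauss_surface_area_measure K2 = density arc_length (\<lambda>v. ennreal (f v))"
proof -
  let ?S = "sphere 0 1 :: (real^2) set"
  obtain \<tau> where \<tau>: "0 < \<tau>" "AE v in arc_length. 1 / \<tau> < f v \<and> f v < \<tau>" using assms(4) by blast
  (* A Borel representative on the whole plane that satisfies the bounds everywhere. *)
  define f' where "f' v = (if v \<in> ?S then max (1/\<tau>) (min \<tau> (f v)) else 1/\<tau>)" for v
  define C where "C = max (1/\<tau>) \<tau>"
  have fm: "f \<in> borel_measurable arc_length" using assms(1) by auto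
  then have fS: "f \<in> borel_measurable (restrict_space borel ?S)"
    by (subst (asm) measurable_cong_sets[OF sets_arc_length refl])
  have f'm [measurable]: "f' \<in> borel_measurable borel"
  proof -
    have "(\<lambda>v. max (1/\<tau>) (min \<tau> (f v))) \<in> borel_measurable (restrict_space borel ?S)"
      using fS by measurable
    then show ?thesis
      unfolding f'_def by (subst (asm) measurable_restrict_space_iff[where c = "1/\<tau>"]) auto
  qed
  have f'_ge: "1/\<tau> \<le> f' v" and f'_le: "f' v \<le> C" for v by (auto simp: f'_def C_def)
  have f'0: "0 \<le> f' v" for v using f'_ge[of v] \<tau>(1) by (meson divide_nonneg_pos order_trans zero_le_one)
  have ae: "AE v in arc_length. f v = f' v \<and> 0 \<le> f v"
    using \<tau>(2) AE_space
  proof eventually_elim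
    case (elim v)
    have "0 < 1 / \<tau>" using \<tau>(1) by simp
    then have "0 \<le> f v" using elim by linarith
    then show ?case using elim by (simp add: f'_def)
  qed
  have dens: "density arc_length (\<lambda>v. ennreal (f' v)) = density arc_length (\<lambda>v. ennreal (f v))"
  proof (rule density_cong)
    show "(\<lambda>v. ennreal (f v)) \<in> borel_measurable arc_length" using fm by measurable
    show "(\<lambda>v. ennreal (f' v)) \<in> borel_measurable arc_length"
      by (subst measurable_cong_sets[OF sets_arc_length refl], rule measurable_restrict_space1) measurable
    show "AE v in arc_length. ennreal (f' v) = ennreal (f v)" using ae by eventually_elim simp
  qed
  define g where "g t = 2 * pi * f' (dir t)" for t
  have even: "f' (- v) = f' v" if "v \<in> ?S" for v using that assms(2) by (simp add: f'_def)
  have fu: "(\<lambda>t. f' (dir t)) \<in> borel_measurable borel" by (rule measurable_compose[OF borel_measurable_dir f'm])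
  have gm: "g \<in> borel_measurable borel" unfolding g_def using fu by measurable
  have gp: "g (t + pi) = g t" for t by (simp add: g_def dir_add_pi even)
  have gc: "2 * pi / \<tau> \<le> g t" for t
    using mult_left_mono[OF f'_ge[of "dir t"], of "2*pi"] by (simp add: g_def)
  have gC: "g t \<le> 2 * pi * C" for t unfolding g_def by (intro mult_left_mono f'_le) simp
  have c: "0 < 2 * pi / \<tau>" using \<tau>(1) by simp
  have small: "integral {0..pi} g < sqrt (pi / 2)"
  proof -
    have f'i: "(\<lambda>t. f' (dir t)) integrable_on {p..q}" for p q
      by (rule bounded_borel_integrable[OF fu, where B = C]) (use f'0 f'_le in auto)
    have "(\<integral>v. \<bar>f v\<bar> \<partial>arc_length) = (\<integral>v. f' v \<partial>arc_length)"
    proof (rule integral_cong_AE)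
      show "f' \<in> borel_measurable arc_length"
        by (subst measurable_cong_sets[OF sets_arc_length refl], rule measurable_restrict_space1) measurable
      show "(\<lambda>v. \<bar>f v\<bar>) \<in> borel_measurable arc_length" using fm by measurable
      show "AE v in arc_length. \<bar>f v\<bar> = f' v" using ae by eventually_elim simp
    qed
    also have "\<dots> = integral {0..2*pi} (\<lambda>t. f' (dir t))"
      by (rule integral_arc_length[OF f'm, of C]) (use f'0 f'_le in auto)
    also have "\<dots> = integral {0..pi} (\<lambda>t. f' (dir t)) + integral {pi..2*pi} (\<lambda>t. f' (dir t))"
      by (rule Henstock_Kurzweil_Integration.integral_combine[symmetric, OF _ _ f'i]) auto
    also have "integral {pi..2*pi} (\<lambda>t. f' (dir t)) = integral {0..pi} (\<lambda>t. f' (dir t))"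
      using integral_shift[of 0 pi pi "\<lambda>t. f' (dir t)"] by (simp add: dir_add_pi even)
    finally have "2 * integral {0..pi} (\<lambda>t. f' (dir t)) < 1 / sqrt (2 * pi)" using assms(3) by simp
    then have "pi * (2 * integral {0..pi} (\<lambda>t. f' (dir t))) < pi * (1 / sqrt (2 * pi))"
      by (intro mult_strict_left_mono) auto
    also have "pi * (1 / sqrt (2 * pi)) = sqrt (pi / 2)"
    proof -
      have "sqrt (pi / 2) * sqrt (2 * pi) = pi" by (simp add: real_sqrt_mult[symmetric])
      then show ?thesis by (simp add: divide_eq_eq)
    qed
    finally show ?thesis unfolding g_def by (simp add: mult_ac)
  qed
  obtain w1 B1 w2 B2 where rf: "radius_function w1 B1" "radius_function w2 B2"
    and w1: "\<And>t. w1 t = g t * exp ((norm (radius_function.curve w1 t))\<^sup>2 / 2)"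
    and w2: "\<And>t. w2 t = g t * exp ((norm (radius_function.curve w2 t))\<^sup>2 / 2)"
    and lt: "radius_function.support w1 0 < radius_function.support w2 0"
    using two_radius_functions[OF gm c gc gC gp small] by blast
  have cc: "convex_curve w B (2 * pi / \<tau>)"
    if "radius_function w B" "\<And>t. w t = g t * exp ((norm (radius_function.curve w t))\<^sup>2 / 2)" for w B
  proof -
    interpret radius_function w B by (rule that(1))
    have "2 * pi / \<tau> \<le> w t" for t
    proof -
      have "(2 * pi / \<tau>) * 1 \<le> g t * exp ((norm (curve t))\<^sup>2 / 2)"
        using gc[of t] c by (intro mult_mono) auto
      then show ?thesis using that(2)[of t] by simp
    qed
    then show ?thesis using c by unfold_locales auto
  qed
  interpret one: convex_curve w1 B1 "2 * pi / \<tau>" by (rule cc[OF rf(1) w1])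
  interpret two: convex_curve w2 B2 "2 * pi / \<tau>" by (rule cc[OF rf(2) w2])
  have "two.curve 0 \<notin> one.body" using lt by (auto simp: one.body_def two.support_def intro!: exI[of _ 0])
  then have "one.body \<noteq> two.body" using two.curve_in_body by blast
  moreover have "gauss_surface_area_measure one.body = density arc_length (\<lambda>v. ennreal (f v))"
    unfolding dens[symmetric]
    by (rule one.gauss_surface_area_measure_body[OF f'm f'0]) (use w1 in \<open>simp add: g_def\<close>)
  moreover have "gauss_surface_area_measure two.body = density arc_length (\<lambda>v. ennreal (f v))"
    unfolding dens[symmetric]
    by (rule two.gauss_surface_area_measure_body[OF f'm f'0]) (use w2 in \<open>simp add: g_def\<close>)
  ultimately show ?thesis
    using one.convex_body_body two.convex_body_body one.origin_symmetric_body two.origin_symmetric_body by blast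
qed

end
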